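(* Let $k\ge 2$ be an even integer, let $\chi$ be an odd primitive Dirichlet character modulo $q$, and let $a,x>0$. Then for every complex $\nu$ with $\Re(\nu)>0$, \begin{align*} \sum_{n=1}^\infty\bar{\sigma}_{k,\chi}(n)n^{\frac{\nu}{2}}K_\nu(a\sqrt{nx})=&\ \frac{2^{\nu+2k+1}}{a^{\nu+2k+2}} \Gamma(k+1)\Gamma(\nu+k+1)L(1+k,\chi)\, x^{-\frac{\nu}{2}-k-1}\\ &-\frac{(-1)^{\frac{k}{2}}i (aq)^\nu x^{\frac{\nu}{2}}}{2^{3\nu+k+2}\pi^{2\nu+k+1}} \Gamma(\nu+k+1)\tau(\chi) \sum_{n=1}^\infty\frac{\sigma_{k,\bar{\chi}}(n)}{\left( n+\frac{a^2qx}{16\pi^2} \right)^{\nu+k+1} } . \end{align*}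
   Context: For a Dirichlet character $\chi$ and $z\in\mathbb{C}$: $\sigma_{z,\chi}(n)=\sum_{d\mid n}d^z\chi(d)$ and $\bar{\sigma}_{z,\chi}(n)=\sum_{d\mid n}d^z\chi(n/d)$. $\tau(\chi)=\sum_{h=1}^q\chi(h)e^{2\pi i h/q}$ is the Gauss sum, $L(s,\chi)$ the Dirichlet $L$-function, and $K_\nu$ the modified Bessel function of the second kind. *)

theory Defs
  imports "HOL-Analysis.Analysis"
begin

definition dirichlet_character :: "nat \<Rightarrow> (int \<Rightarrow> complex) \<Rightarrow> bool" where
  "dirichlet_character q \<psi> \<longleftrightarrow> q > 0 \<and>
     (\<forall>m n. \<psi> (m * n) = \<psi> m * \<psi> n) \<and>
     (\<forall>n. \<psi> (n + int q) = \<psi> n) \<and>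
     (\<forall>n. \<psi> n \<noteq> 0 \<longleftrightarrow> coprime n (int q))"

definition induced_modulus :: "nat \<Rightarrow> (int \<Rightarrow> complex) \<Rightarrow> nat \<Rightarrow> bool" where
  "induced_modulus q \<psi> d \<longleftrightarrow> d dvd q \<and>
     (\<forall>n. coprime n (int q) \<and> n mod int d = 1 mod int d \<longrightarrow> \<psi> n = 1)"

definition primitive_character :: "nat \<Rightarrow> (int \<Rightarrow> complex) \<Rightarrow> bool" where
  "primitive_character q \<psi> \<longleftrightarrow> dirichlet_character q \<psi> \<and>
     (\<forall>d. induced_modulus q \<psi> d \<longrightarrow> d = q)"

definition odd_character :: "(int \<Rightarrow> complex) \<Rightarrow> bool" where
  "odd_character \<psi> \<longleftrightarrow> \<psi> (-1) = -1"

definition gauss_sum :: "nat \<Rightarrow> (int \<Rightarrow> complex) \<Rightarrow> complex" where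
  "gauss_sum q \<psi> = (\<Sum>h=1..q. \<psi> (int h) * exp (2 * of_real pi * \<i> * of_nat h / of_nat q))"

text \<open>Dirichlet L-function (by its Dirichlet series; used here only for Re s > 1).\<close>
definition dirichlet_L :: "(int \<Rightarrow> complex) \<Rightarrow> complex \<Rightarrow> complex" where
  "dirichlet_L \<psi> s = (\<Sum>n. \<psi> (int (Suc n)) / (of_nat (Suc n)) powr s)"

definition sigma_chi :: "complex \<Rightarrow> (int \<Rightarrow> complex) \<Rightarrow> nat \<Rightarrow> complex" where
  "sigma_chi z \<psi> n = (\<Sum>d | d dvd n. (of_nat d) powr z * \<psi> (int d))"

definition sigma_bar_chi :: "complex \<Rightarrow> (int \<Rightarrow> complex) \<Rightarrow> nat \<Rightarrow> complex" where
  "sigma_bar_chi z \<psi> n = (\<Sum>d | d dvd n. (of_nat d) powr z * \<psi> (int (n div d)))"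

text \<open>Modified Bessel function of the second kind, for x > 0 and any complex order,
  via K_nu(x) = integral_0^infty exp(-x cosh t) cosh(nu t) dt.\<close>
definition besselK :: "complex \<Rightarrow> real \<Rightarrow> complex" where
  "besselK \<nu> x = integral {0..} (\<lambda>t::real. exp (- of_real (x * cosh t)) * cosh (\<nu> * of_real t))"

end

theory Submission
  imports Defs
begin

text \<open>
  Up to a factor \<open>2b\<^bsup>\<nu>/2\<^esup>\<close>, \<open>K\<^sub>\<nu>(a\<surd>(nx))\<close> is \<open>\<integral> t\<^bsup>\<nu>-1\<^esup> e\<^bsup>-t-b/t\<^esup> dt\<close> over \<open>t > 0\<close>, with \<open>b = a\<^sup>2nx/4\<close>. The series on the left becomes the
  integral of \<open>t\<^bsup>\<nu>-1\<^esup> e\<^bsup>-t\<^esup> T(y)\<close>, where \<open>T(y)\<close> is the Lambert series of \<open>d\<^sup>k \<psi>(m) e\<^bsup>-dmy\<^esup>\<close> over \<open>d, m \<ge> 1\<close>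
  and \<open>y = a\<^sup>2x/(4t)\<close>. Summing over \<open>d\<close> by the Lipschitz formula turns \<open>T(y)\<close> into \<open>k!\<close> times the sum of
  \<open>\<psi>(m) (my - 2\<pi>il)\<^bsup>-k-1\<^esup>\<close> over \<open>m \<ge> 1\<close> and all integers \<open>l\<close>. The terms \<open>l = 0\<close> give the main term. As \<open>k + 1\<close> and
  \<open>\<psi>\<close> are odd, the others combine into sums over all integers \<open>m\<close>, to which the Lipschitz formula applies
  again, now on residue classes modulo \<open>q\<close>. Primitivity makes the Gauss sum appear, and the dual Lambert
  series carries \<open>e\<^bsup>-4\<pi>\<^sup>2n/(qy)\<^esup>\<close>, which is exponential in \<open>t\<close>, so its terms integrate to Gamma factors.
\<close>

subsection \<open>Dirichlet characters and Gauss sums\<close>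

lemma dirichlet_character_1:
  assumes "dirichlet_character q \<psi>"
  shows "\<psi> 1 = 1"
proof -
  have "\<psi> 1 = \<psi> 1 * \<psi> 1" "\<psi> 1 \<noteq> 0"
    using assms unfolding dirichlet_character_def by (metis mult_1, simp)
  thus ?thesis by simp
qed

lemma dirichlet_character_add_mult:
  assumes "dirichlet_character q \<psi>"
  shows "\<psi> (n + int q * k) = \<psi> n"
proof -
  have per: "\<psi> (n + int q) = \<psi> n" for n
    using assms unfolding dirichlet_character_def by blast
  have nat: "\<psi> (n + int q * int j) = \<psi> n" for n j
  proof (induction j)
    case (Suc j)
    have "\<psi> (n + int q * int (Suc j)) = \<psi> ((n + int q * int j) + int q)"
      by (simp add: algebra_simps)
    thus ?case using Suc per by simp
  qed simp
  show ?thesis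
  proof (cases "k \<ge> 0")
    case True
    thus ?thesis using nat[of n "nat k"] by simp
  next
    case False
    thus ?thesis using nat[of "n + int q * k" "nat (-k)"] by (simp add: algebra_simps)
  qed
qed

lemma dirichlet_character_mod:
  assumes "dirichlet_character q \<psi>"
  shows "\<psi> (n mod int q) = \<psi> n"
  using dirichlet_character_add_mult[OF assms, of "n mod int q" "n div int q"] by simp

text \<open>By periodicity only finitely many values occur, so the norms are bounded by their
  maximum \<open>M\<close> over the residues. A value of norm above 1 would have unbounded powers,
  and these are again values, taken at \<open>n ^ j\<close>.\<close>

lemma dirichlet_character_norm_le_1:
  assumes "dirichlet_character q \<psi>"
  shows "norm (\<psi> n) \<le> 1"
proof (rule ccontr)
  assume "\<not> norm (\<psi> n) \<le> 1"
  hence gt: "norm (\<psi> n) > 1" by simp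
  have q: "q > 0" using assms unfolding dirichlet_character_def by blast
  define M where "M = Max ((\<lambda>r. norm (\<psi> r)) ` {0..<int q})"
  have M: "norm (\<psi> m) \<le> M" for m
    unfolding dirichlet_character_mod[OF assms, of m, symmetric] M_def
    using q by (intro Max_ge) auto
  have pow: "\<psi> (n ^ j) = \<psi> n ^ j" for j
    using assms dirichlet_character_1[OF assms]
    by (induction j) (auto simp: dirichlet_character_def)
  obtain j where "norm (\<psi> n) ^ j > M"
    using real_arch_pow[OF gt] by blast
  thus False using M[of "n ^ j"] by (simp add: pow norm_power)
qed

lemma coprime_int_inverse_mod:
  assumes "coprime n (int q)"
  obtains c where "coprime c (int q)" "(c * n) mod int q = 1 mod int q"
proof -
  obtain u v where uv: "u * n + v * int q = 1"
    using bezout_int[of n "int q"] assms by auto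
  have "(u * n) mod int q = (u * n + v * int q) mod int q" by simp
  moreover have "coprime u (int q)"
  proof (rule coprimeI)
    fix d assume "d dvd u" "d dvd int q"
    hence "d dvd u * n + v * int q" by simp
    thus "is_unit d" using uv by simp
  qed
  ultimately show ?thesis using that uv by simp
qed

text \<open>The values at \<open>c\<close> and \<open>n\<close> multiply to 1 and both have norm at
  most 1. Hence both lie on the unit circle, where inversion is conjugation.\<close>

lemma dirichlet_character_inverse_eq_cnj:
  assumes "dirichlet_character q \<psi>" and "(c * n) mod int q = 1 mod int q"
  shows "\<psi> c = cnj (\<psi> n)"
proof -
  have mul: "\<psi> c * \<psi> n = 1"
    using dirichlet_character_mod[OF assms(1), of "c * n"] dirichlet_character_mod[OF assms(1), of 1]
      assms dirichlet_character_1[OF assms(1)] unfolding dirichlet_character_def by simp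
  have "norm (\<psi> c) * norm (\<psi> n) = 1"
    using mul by (metis norm_mult norm_one)
  hence "norm (\<psi> n) = 1"
    using dirichlet_character_norm_le_1[OF assms(1)]
    by (smt (verit) mult_left_le_one_le mult_right_le_one_le norm_ge_zero)
  hence "cnj (\<psi> n) * \<psi> n = 1"
    by (metis complex_norm_square mult.commute of_real_1 one_power2)
  with mul show ?thesis by (metis mult_cancel_right mult_zero_right zero_neq_one)
qed

text \<open>Multiplication by a unit permutes the residues modulo \<open>q\<close>. This is the
  substitution behind the evaluation of twisted Gauss sums.\<close>

lemma sum_residues_mult:
  fixes f :: "int \<Rightarrow> 'a :: comm_monoid_add"
  assumes "q > 0" and "\<And>n. f (n mod int q) = f n" and "coprime c (int q)"
  shows "(\<Sum>r\<in>{0..<int q}. f (c * r)) = (\<Sum>r\<in>{0..<int q}. f r)"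
proof -
  have inj: "inj_on (\<lambda>r. (c * r) mod int q) {0..<int q}"
  proof (rule inj_onI)
    fix r s assume *: "r \<in> {0..<int q}" "s \<in> {0..<int q}" "(c * r) mod int q = (c * s) mod int q"
    hence "int q dvd c * r - c * s" by (simp add: mod_eq_dvd_iff)
    hence "int q dvd c * (r - s)" by (simp add: right_diff_distrib)
    hence "int q dvd r - s"
      using assms(3) by (simp add: coprime_commute coprime_dvd_mult_right_iff)
    thus "r = s" using * by (metis atLeastLessThan_iff mod_eq_dvd_iff mod_pos_pos_trivial)
  qed
  have "(\<lambda>r. (c * r) mod int q) ` {0..<int q} \<subseteq> {0..<int q}"
    using assms(1) by auto
  hence im: "(\<lambda>r. (c * r) mod int q) ` {0..<int q} = {0..<int q}"
    using inj by (intro endo_inj_surj) auto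
  have "(\<Sum>r\<in>{0..<int q}. f (c * r)) = (\<Sum>r\<in>{0..<int q}. f ((c * r) mod int q))"
    by (simp add: assms(2))
  also have "\<dots> = (\<Sum>r\<in>(\<lambda>r. (c * r) mod int q) ` {0..<int q}. f r)"
    using sum.reindex[OF inj, of f] by simp
  finally show ?thesis by (simp add: im)
qed

lemma exp_residue_mod:
  assumes "q > 0"
  shows "exp (2 * of_real pi * \<i> * of_int (r mod int q) / of_nat q) =
         exp (2 * of_real pi * \<i> * of_int r / of_nat q)"
proof -
  have "(of_int r :: complex) = of_int (r mod int q) + of_int (r div int q) * of_nat q"
    by (metis mod_mult_div_eq of_int_add of_int_mult of_int_of_nat_eq mult.commute)
  hence "2 * of_real pi * \<i> * of_int r / of_nat q =
      2 * of_real pi * \<i> * of_int (r mod int q) / of_nat q + of_int (2 * (r div int q)) * of_real pi * \<i>"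
    using assms by (simp add: field_simps)
  thus ?thesis
    using exp_integer_2pi[of "of_int (r div int q)"] by (simp only: exp_add) simp
qed

lemma gauss_sum_eq_sum_residues:
  assumes "dirichlet_character q \<psi>"
  shows "gauss_sum q \<psi> = (\<Sum>r\<in>{0..<int q}. \<psi> r * exp (2 * of_real pi * \<i> * of_int r / of_nat q))"
proof -
  define f where "f r = \<psi> r * exp (2 * of_real pi * \<i> * of_int r / of_nat q)" for r
  have q: "q > 0" using assms unfolding dirichlet_character_def by blast
  \<comment> \<open>\<open>gauss_sum\<close> runs over 1 to \<open>q\<close>, the residue system
    over 0 to \<open>q - 1\<close>; the two end terms agree by periodicity.\<close>
  have f0: "f (int q) = f 0"
    using exp_residue_mod[OF q, of "int q"] dirichlet_character_mod[OF assms, of "int q"]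
    by (simp add: f_def)
  have "gauss_sum q \<psi> = (\<Sum>h=1..q. f (int h))"
    unfolding gauss_sum_def f_def by simp
  also have "\<dots> = (\<Sum>h\<in>{1..<q}. f (int h)) + f (int q)"
    using q by (simp add: sum.last_plus atLeastLessThanSuc_atLeastAtMost[symmetric] add.commute)
  also have "\<dots> = (\<Sum>h\<in>{0..<q}. f (int h))"
    using q by (simp add: f0 sum.atLeast_Suc_lessThan add.commute)
  also have "\<dots> = (\<Sum>r\<in>{0..<int q}. f r)"
    by (rule sum.reindex_bij_witness[of _ nat int]) auto
  finally show ?thesis unfolding f_def .
qed

text \<open>For \<open>n\<close> coprime to \<open>q\<close>, substituting an inverse of
  \<open>n\<close> reduces to the Gauss sum itself. For other \<open>n\<close> the right-hand side
  is 0, and primitivity forces the left-hand side to vanish as well: it is fixed under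
  multiplication by some \<open>\<psi> c\<close> different from 1.\<close>

lemma primitive_character_gauss_sum_twisted:
  assumes "primitive_character q \<psi>"
  shows "(\<Sum>r\<in>{0..<int q}. \<psi> r * exp (2 * of_real pi * \<i> * of_int (n * r) / of_nat q)) =
         cnj (\<psi> n) * gauss_sum q \<psi>"
proof -
  have dc: "dirichlet_character q \<psi>" using assms unfolding primitive_character_def by blast
  hence q: "q > 0" and mult: "\<psi> (m * l) = \<psi> m * \<psi> l" and nz: "\<psi> m \<noteq> 0 \<longleftrightarrow> coprime m (int q)" for m l
    unfolding dirichlet_character_def by auto
  define e where "e r = exp (2 * of_real pi * \<i> * of_int r / of_nat q)" for r :: int
  have e: "e (r mod int q) = e r" for r unfolding e_def by (rule exp_residue_mod[OF q])
  define S where "S n = (\<Sum>r\<in>{0..<int q}. \<psi> r * e (n * r))" for n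
  have shift: "S n = \<psi> c * S (c * n)" if "coprime c (int q)" for c n
  proof -
    have "S n = (\<Sum>r\<in>{0..<int q}. \<psi> (c * r) * e (n * (c * r)))"
      unfolding S_def
    proof (rule sum_residues_mult[OF q _ that, symmetric])
      fix m show "\<psi> (m mod int q) * e (n * (m mod int q)) = \<psi> m * e (n * m)"
        by (metis e dirichlet_character_mod[OF dc] mod_mult_right_eq)
    qed
    thus ?thesis by (simp add: S_def mult sum_distrib_left mult_ac)
  qed
  have S_mod: "S m = S n" if "m mod int q = n mod int q" for m n
    unfolding S_def by (intro sum.cong refl arg_cong2[of _ _ _ _ "(*)"]) (metis e mod_mult_left_eq that)
  have S1: "S 1 = gauss_sum q \<psi>"
    unfolding gauss_sum_eq_sum_residues[OF dc] S_def e_def by simp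
  have "S n = cnj (\<psi> n) * gauss_sum q \<psi>"
  proof (cases "coprime n (int q)")
    case True
    then obtain c where c: "coprime c (int q)" "(c * n) mod int q = 1 mod int q"
      by (rule coprime_int_inverse_mod)
    thus ?thesis
      using shift[OF c(1), of n] S_mod[OF c(2)] S1 dirichlet_character_inverse_eq_cnj[OF dc c(2)] by simp
  next
    case False
    define g where "g = gcd n (int q)"
    have "g \<noteq> 1" using False unfolding g_def by (simp add: coprime_iff_gcd_eq_1)
    moreover have "g > 0" using q unfolding g_def by simp
    ultimately have "g > 1" by linarith
    hence g: "g dvd n" "g dvd int q" "g > 1"
      by (auto simp: g_def)
    \<comment> \<open>Since \<open>g\<close> > 1, \<open>d\<close> is a proper divisor of
      \<open>q\<close>, so primitivity supplies a unit \<open>c\<close> that is 1 modulo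
      \<open>d\<close> with \<open>\<psi> c\<close> not 1. As \<open>g\<close> divides
      \<open>n\<close>, multiplying \<open>n\<close> by this \<open>c\<close> does not change it
      modulo \<open>q\<close>.\<close>
    define d where "d = nat (int q div g)"
    have d: "int q = g * int d" unfolding d_def using g q by (simp add: pos_imp_zdiv_nonneg_iff)
    have "d dvd q" using d by (metis dvd_triv_right int_dvd_int_iff)
    moreover have "d \<noteq> q"
    proof
      assume "d = q"
      hence "int q = g * int q" using d by simp
      thus False using g q by simp
    qed
    ultimately have "\<not> (\<forall>m. coprime m (int q) \<and> m mod int d = 1 mod int d \<longrightarrow> \<psi> m = 1)"
      using assms unfolding primitive_character_def induced_modulus_def by blast
    then obtain c where c: "coprime c (int q)" "c mod int d = 1 mod int d" "\<psi> c \<noteq> 1" by blast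
    have "int d dvd c - 1" using c(2) by (simp add: mod_eq_dvd_iff)
    hence "int q dvd n * (c - 1)" using g(1) unfolding d by (intro mult_dvd_mono)
    hence "int q dvd c * n - n" by (simp add: right_diff_distrib mult.commute)
    hence "(c * n) mod int q = n mod int q" by (simp only: mod_eq_dvd_iff)
    from S_mod[OF this] have "S n = \<psi> c * S n" using shift[OF c(1), of n] by argo
    hence "S n = 0" using c(3) by simp
    thus ?thesis using nz[of n] False by simp
  qed
  thus ?thesis unfolding S_def e_def .
qed

text \<open>The map from \<open>(m, d)\<close> to \<open>(m * d, d)\<close> is a bijection from
  pairs of positive integers onto pairs of a positive integer and one of its divisors. The first
  argument of \<open>f\<close> is thus the cofactor, the second the divisor.\<close>

lemma has_sum_divisors:
  fixes f :: "nat \<times> nat \<Rightarrow> 'a :: {topological_comm_monoid_add, t3_space}"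
  assumes "(f has_sum S) ({1..} \<times> {1..})"
  shows "((\<lambda>n. \<Sum>d | d dvd n. f (n div d, d)) has_sum S) {1..}"
proof -
  have "(f has_sum S) ({1..} \<times> {1..}) \<longleftrightarrow>
      ((\<lambda>(n,d). f (n div d, d)) has_sum S) (Sigma {1..} (\<lambda>n. {d. d dvd n}))"
    by (rule has_sum_reindex_bij_witness[of _ "\<lambda>(n,d). (n div d, d)" "\<lambda>(m,d). (m * d, d)"])
       (auto simp: Suc_le_eq dvd_pos_nat elim!: dvdE)
  with assms have "((\<lambda>(n,d). f (n div d, d)) has_sum S) (Sigma {1..} (\<lambda>n. {d. d dvd n}))" by simp
  thus ?thesis
    by (rule has_sum_SigmaD) (auto intro!: has_sum_finite)
qed

subsection \<open>The Lipschitz summation formula\<close>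

text \<open>A single term of the exponential series bounds exp(u) from below. Choosing
  \<open>p\<close> freely makes this the source of the polynomial majorants for the exponential
  terms below.\<close>

lemma exp_minus_le_fact_div_power:
  fixes u :: real
  assumes "u > 0"
  shows "exp (-u) \<le> fact p / u ^ p"
proof -
  have "u ^ p / fact p \<le> (\<Sum>n. u ^ n / fact n)"
    using sum_le_suminf[of "\<lambda>n. u ^ n / fact n" "{p}"] summable_exp[of u] assms
    by (auto simp: field_simps)
  also have "\<dots> = exp u"
    by (simp add: exp_def scaleR_conv_of_real field_simps)
  finally show ?thesis
    using assms by (simp add: exp_minus field_simps)
qed

text \<open>For \<open>j\<close> > 0 and |w| < 1 this is the polylogarithm of order -j. For
  \<open>j\<close> = 0 the term at \<open>n\<close> = 0 counts as 1, because 0 ^ 0 = 1, and the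
  value is the full geometric series 1 / (1 - w).\<close>

definition power_moment :: "nat \<Rightarrow> complex \<Rightarrow> complex" where
  "power_moment j w = (\<Sum>n. of_nat n ^ j * w ^ n)"

lemma summable_norm_power_moment:
  assumes "norm (w :: complex) < 1"
  shows "summable (\<lambda>n. norm (of_nat n ^ j * w ^ n))"
\<comment> \<open>The logarithmic decay rate \<open>u\<close> exists only for nonzero
  \<open>w\<close>; at \<open>w\<close> = 0 all terms with \<open>n\<close> >= 1 vanish.\<close>
proof (cases "w = 0")
  case True
  show ?thesis unfolding True
    by (rule summable_comparison_test_ev[OF _ summable_geometric[of "1/2::real"]])
       (auto intro!: eventually_sequentiallyI[of 1] simp: power_0_left)
next
  case False
  define u where "u = - ln (norm w)"
  have u: "u > 0" unfolding u_def using assms False by simp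
  have wu: "norm w = exp (-u)" using False by (simp add: u_def)
  have "summable (\<lambda>n. fact (j + 2) / u ^ (j + 2) * inverse (real n ^ 2))"
    by (intro summable_mult inverse_power_summable) auto
  thus ?thesis
  proof (rule summable_comparison_test_ev[rotated], intro eventually_sequentiallyI[of 1])
    fix n :: nat assume n: "n \<ge> 1"
    have "norm (norm (of_nat n ^ j * w ^ n)) = real n ^ j * exp (-(n * u))"
      by (simp add: norm_mult norm_power wu exp_of_nat_mult flip: exp_of_nat_mult)
    \<comment> \<open>The order \<open>j + 2\<close> cancels the factor \<open>n ^ j\<close> and
      leaves an inverse square.\<close>
    also have "\<dots> \<le> real n ^ j * (fact (j + 2) / (n * u) ^ (j + 2))"
      using n u by (intro mult_left_mono exp_minus_le_fact_div_power) auto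
    also have "\<dots> = fact (j + 2) / u ^ (j + 2) * inverse (real n ^ 2)"
      using n u by (simp add: power_mult_distrib power_add power2_eq_square divide_simps del: fact_Suc)
    finally show "norm (norm (of_nat n ^ j * w ^ n)) \<le> fact (j + 2) / u ^ (j + 2) * inverse (real n ^ 2)" .
  qed
qed

lemma has_sum_power_moment:
  assumes "norm w < 1" and "j > 0"
  shows "((\<lambda>n. of_nat n ^ j * w ^ n) has_sum power_moment j w) {1..}"
proof -
  have "((\<lambda>n. of_nat n ^ j * w ^ n) has_sum power_moment j w) UNIV"
    unfolding power_moment_def using summable_norm_power_moment[OF assms(1)]
    by (intro norm_summable_imp_has_sum summable_sums) (auto intro: summable_norm_cancel)
  also have "?this \<longleftrightarrow> ?thesis"
    by (rule has_sum_cong_neutral) (use assms(2) in \<open>auto simp: not_le\<close>)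
  finally show ?thesis .
qed

text \<open>The operator w d/dw multiplies the n-th coefficient by n, which raises the index by
  one.\<close>

lemma has_field_derivative_power_moment:
  assumes "norm w < 1" "w \<noteq> 0"
  shows "(power_moment j has_field_derivative power_moment (Suc j) w / w) (at w)"
proof -
  obtain K where K: "norm w < K" "K < 1" using dense[OF assms(1)] by blast
  define c :: "nat \<Rightarrow> complex" where "c n = of_nat n ^ j" for n
  have "norm (of_real K :: complex) < 1" unfolding norm_of_real using K norm_ge_zero[of w] by linarith
  hence sK: "summable (\<lambda>n. c n * of_real K ^ n)"
    unfolding c_def by (rule summable_norm_cancel[OF summable_norm_power_moment])
  have "((\<lambda>w. \<Sum>n. c n * w ^ n) has_field_derivative (\<Sum>n. diffs c n * w ^ n)) (at w)"
    by (rule termdiffs_strong[OF sK]) (use K in auto)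
  moreover have "(\<Sum>n. diffs c n * w ^ n) = power_moment (Suc j) w / w"
  proof -
    have sum: "summable (\<lambda>n. of_nat n ^ Suc j * w ^ n)"
      by (rule summable_norm_cancel[OF summable_norm_power_moment[OF assms(1)]])
    have "power_moment (Suc j) w = (\<Sum>n. of_nat (Suc n) ^ Suc j * w ^ Suc n)"
      unfolding power_moment_def using suminf_split_head[OF sum] by simp
    also have "\<dots> / w = (\<Sum>n. of_nat (Suc n) ^ Suc j * w ^ Suc n / w)"
      by (intro suminf_divide[symmetric]) (subst summable_Suc_iff, fact sum)
    also have "\<dots> = (\<Sum>n. diffs c n * w ^ n)"
      unfolding diffs_def c_def using assms(2) by (intro suminf_cong) simp
    finally show ?thesis by simp
  qed
  ultimately show ?thesis by (simp add: c_def power_moment_def[abs_def])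
qed

section \<open>Reflection formulas for polygamma functions in the upper half-plane\<close>

lemma norm_exp_2pi_ii_less_1:
  assumes "Im z > 0"
  shows "norm (exp (2 * of_real pi * \<i> * z)) < 1"
  using assms by simp

lemma not_nonpos_Ints_of_Im_nonzero:
  assumes "Im z \<noteq> 0"
  shows "z \<notin> \<int>\<^sub>\<le>\<^sub>0"
  using assms by (auto elim!: nonpos_Ints_cases)

text \<open>This is the logarithmic derivative of the reflection formula, taken for the entire
  function \<open>rGamma\<close>. It gives pi cot(pi z), which is then expanded as a geometric
  series in exp(2 pi i z), convergent because Im z > 0.\<close>

lemma Digamma_reflection_upper_half_plane:
  assumes "Im z > 0"
  shows "Digamma (1 - z) - Digamma z =
         of_real pi * \<i> - 2 * of_real pi * \<i> * power_moment 0 (exp (2 * of_real pi * \<i> * z))"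
proof -
  define s where "s = sin (of_real pi * z)"
  \<comment> \<open>\<open>w\<close> is a square root of the variable exp(2 pi i z), chosen so that
    sine and cosine become rational functions of it.\<close>
  define w where "w = exp (\<i> * (of_real pi * z))"
  have w0: "w \<noteq> 0" by (simp add: w_def)
  have w2: "exp (2 * of_real pi * \<i> * z) = w ^ 2"
    unfolding w_def by (simp flip: exp_double add: mult_ac)
  have wless: "norm (w ^ 2) < 1"
    using norm_exp_2pi_ii_less_1[OF assms] by (simp add: w2)
  have w21: "w ^ 2 \<noteq> 1" using wless by auto
  have sw: "s = (w - inverse w) / (2 * \<i>)"
    unfolding s_def sin_exp_eq w_def by (simp add: exp_minus)
  have cw: "cos (of_real pi * z) = (w + inverse w) / 2"
    unfolding cos_exp_eq w_def by (simp add: exp_minus)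
  have s0: "s \<noteq> 0"
    using w21 w0 unfolding sw by (auto simp: field_simps power2_eq_square)
  have n1: "z \<notin> \<int>\<^sub>\<le>\<^sub>0" "1 - z \<notin> \<int>\<^sub>\<le>\<^sub>0"
    using assms by (auto intro!: not_nonpos_Ints_of_Im_nonzero)
  have refl: "rGamma u * rGamma (1 - u) = sin (of_real pi * u) / of_real pi" for u :: complex
    by (rule rGamma_reflection_complex)
  have "((\<lambda>u. rGamma u * rGamma (1 - u)) has_field_derivative
      (rGamma z * rGamma (1 - z)) * (Digamma (1 - z) - Digamma z)) (at z)"
    using n1 by (auto intro!: derivative_eq_intros simp: algebra_simps)
  moreover have "((\<lambda>u. rGamma u * rGamma (1 - u)) has_field_derivative cos (of_real pi * z)) (at z)"
    unfolding refl by (auto intro!: derivative_eq_intros)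
  ultimately have "s / of_real pi * (Digamma (1 - z) - Digamma z) = cos (of_real pi * z)"
    unfolding refl s_def by (rule DERIV_unique)
  hence "Digamma (1 - z) - Digamma z = of_real pi * cos (of_real pi * z) / s"
    using s0 by (simp add: field_simps)
  also have "\<dots> = of_real pi * \<i> * (w ^ 2 + 1) / (w ^ 2 - 1)"
    using w0 w21 unfolding cw sw by (simp add: field_simps power2_eq_square)
  also have "\<dots> = of_real pi * \<i> - 2 * of_real pi * \<i> * (1 / (1 - w ^ 2))"
    using w21 by (simp add: divide_simps) (simp add: algebra_simps)
  also have "1 / (1 - w ^ 2) = power_moment 0 (w ^ 2)"
    unfolding power_moment_def using suminf_geometric[OF wless] by simp
  finally show ?thesis by (simp add: w2)
qed

text \<open>Repeated differentiation of the digamma reflection. The statement starts at order 1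
  because the additive constant pi i disappears with the first derivative.\<close>

lemma Polygamma_reflection_upper_half_plane:
  assumes "Im z > 0"
  shows "(-1) ^ Suc j * Polygamma (Suc j) (1 - z) - Polygamma (Suc j) z =
         - ((2 * of_real pi * \<i>) ^ (j + 2) * power_moment (Suc j) (exp (2 * of_real pi * \<i> * z)))"
proof -
  define e where "e z = exp (2 * of_real pi * \<i> * z)" for z :: complex
  have op: "open {z. Im z > 0}" by (simp add: open_halfspace_Im_gt)
  have derL: "((\<lambda>z. (-1) ^ i * Polygamma i (1 - z) - Polygamma i z) has_field_derivative
       (-1) ^ Suc i * Polygamma (Suc i) (1 - z) - Polygamma (Suc i) z) (at z)"
    if "Im z > 0" for i z
    using that by (auto intro!: derivative_eq_intros not_nonpos_Ints_of_Im_nonzero)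
  have derR: "((\<lambda>z. power_moment i (e z)) has_field_derivative
       2 * of_real pi * \<i> * power_moment (Suc i) (e z)) (at z)" if "Im z > 0" for i z
  proof -
    have "(e has_field_derivative e z * (2 * of_real pi * \<i>)) (at z)"
      unfolding e_def by (auto intro!: derivative_eq_intros)
    moreover have "(power_moment i has_field_derivative power_moment (Suc i) (e z) / e z) (at (e z))"
      using norm_exp_2pi_ii_less_1[OF that] by (intro has_field_derivative_power_moment) (auto simp: e_def)
    ultimately have "((\<lambda>z. power_moment i (e z)) has_field_derivative
        power_moment (Suc i) (e z) / e z * (e z * (2 * of_real pi * \<i>))) (at z)"
      by (rule DERIV_chain2[rotated])
    thus ?thesis by (simp add: e_def mult_ac)
  qed
  have "(-1) ^ Suc j * Polygamma (Suc j) (1 - z) - Polygamma (Suc j) z =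
         - ((2 * of_real pi * \<i>) ^ (j + 2) * power_moment (Suc j) (e z))"
    using assms
  proof (induction j arbitrary: z)
    case 0
    have "((\<lambda>z. of_real pi * \<i> - 2 * of_real pi * \<i> * power_moment 0 (e z)) has_field_derivative
        - (2 * of_real pi * \<i> * (2 * of_real pi * \<i> * power_moment (Suc 0) (e z)))) (at z)"
      using 0 by (auto intro!: derivative_eq_intros derR)
    \<comment> \<open>The digamma identity holds on the whole open half-plane, so the right-hand
      side inherits the derivative of the left-hand side; uniqueness of derivatives then gives the
      claim.\<close>
    moreover have "((\<lambda>z. of_real pi * \<i> - 2 * of_real pi * \<i> * power_moment 0 (e z)) has_field_derivative
        (-1) ^ Suc 0 * Polygamma (Suc 0) (1 - z) - Polygamma (Suc 0) z) (at z)"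
      by (rule has_field_derivative_transform_within_open[OF derL[OF 0] op])
         (use 0 Digamma_reflection_upper_half_plane in \<open>auto simp: e_def\<close>)
    ultimately show ?case
      using DERIV_unique by (fastforce simp: power2_eq_square mult_ac)
  next
    case (Suc j)
    have "((\<lambda>z. - ((2 * of_real pi * \<i>) ^ (j + 2) * power_moment (Suc j) (e z))) has_field_derivative
        - ((2 * of_real pi * \<i>) ^ (j + 2) * (2 * of_real pi * \<i> * power_moment (Suc (Suc j)) (e z)))) (at z)"
      using Suc.prems by (auto intro!: derivative_eq_intros derR)
    moreover have "((\<lambda>z. - ((2 * of_real pi * \<i>) ^ (j + 2) * power_moment (Suc j) (e z))) has_field_derivative
        (-1) ^ Suc (Suc j) * Polygamma (Suc (Suc j)) (1 - z) - Polygamma (Suc (Suc j)) z) (at z)"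
      by (rule has_field_derivative_transform_within_open[OF derL[OF Suc.prems] op])
         (use Suc in auto)
    ultimately have "(-1) ^ Suc (Suc j) * Polygamma (Suc (Suc j)) (1 - z) - Polygamma (Suc (Suc j)) z =
        - ((2 * of_real pi * \<i>) ^ (j + 2) * (2 * of_real pi * \<i> * power_moment (Suc (Suc j)) (e z)))"
      by (rule DERIV_unique[rotated])
    thus ?case by (simp add: mult_ac)
  qed
  thus ?thesis unfolding e_def .
qed

text \<open>The library gives an ordered series. It becomes an unconditional sum by absolute
  convergence: |z + n| >= n/2 as soon as n >= 2|z|.\<close>

lemma has_sum_Polygamma:
  fixes z :: complex
  assumes "z \<noteq> 0" "k > 0"
  shows "((\<lambda>n. inverse ((z + of_nat n) ^ Suc k)) has_sum ((-1) ^ Suc k * Polygamma k z / fact k)) UNIV"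
proof (rule norm_summable_imp_has_sum[OF _ Polygamma_LIMSEQ[OF assms]])
  obtain N :: nat where N: "real N \<ge> 2 * norm z" using real_arch_simple by blast
  have "summable (\<lambda>n. 2 ^ Suc k * inverse (real n ^ Suc k))"
    using assms(2) by (intro summable_mult inverse_power_summable) auto
  thus "summable (\<lambda>n. norm (inverse ((z + of_nat n) ^ Suc k)))"
  proof (rule summable_comparison_test_ev[rotated], intro eventually_sequentiallyI[of "max 1 N"])
    fix n :: nat assume n: "max 1 N \<le> n"
    have "real n \<le> norm (z + of_nat n) + norm z"
      using norm_triangle_ineq[of "z + of_nat n" "-z"] by simp
    hence "real n / 2 \<le> norm (z + of_nat n)" using N n by linarith
    hence "inverse (norm (z + of_nat n) ^ Suc k) \<le> inverse ((real n / 2) ^ Suc k)"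
      using n by (intro le_imp_inverse_le power_mono) auto
    also have "\<dots> = 2 ^ Suc k * inverse (real n ^ Suc k)"
      by (simp add: power_divide divide_simps)
    finally show "norm (norm (inverse ((z + of_nat n) ^ Suc k))) \<le> 2 ^ Suc k * inverse (real n ^ Suc k)"
      by (simp add: norm_inverse norm_power del: power_Suc)
  qed
qed

text \<open>The terms with l >= 0 sum to a polygamma value at z and those with l < 0 to one at 1 -
  z. The reflection formula combines the two into a power series in exp(2 pi i z).\<close>

lemma Lipschitz_summation_formula:
  assumes "Im z > 0" and "k > 0"
  shows "((\<lambda>l::int. inverse ((z + of_int l) ^ Suc k)) has_sum
          ((- 2 * of_real pi * \<i>) ^ Suc k / fact k * power_moment k (exp (2 * of_real pi * \<i> * z)))) UNIV"
proof -
  have z: "z \<noteq> 0" "1 - z \<noteq> 0" using assms by (auto simp: complex_eq_iff)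
  let ?f = "\<lambda>l::int. inverse ((z + of_int l) ^ Suc k)"
  let ?S = "(-1) ^ Suc k * Polygamma k z / fact k" and ?T = "Polygamma k (1 - z) / fact k"
  have "((\<lambda>n. inverse ((z + of_nat n) ^ Suc k)) has_sum ?S) UNIV \<longleftrightarrow> (?f has_sum ?S) {0..}"
    by (rule has_sum_reindex_bij_witness[of _ nat int]) auto
  hence pos: "(?f has_sum ?S) {0..}" using has_sum_Polygamma[OF z(1) assms(2)] by simp
  have "((\<lambda>n. (-1) ^ Suc k * inverse ((1 - z + of_nat n) ^ Suc k)) has_sum
      ((-1) ^ Suc k * ((-1) ^ Suc k * Polygamma k (1 - z) / fact k))) UNIV"
    by (intro has_sum_cmult_right has_sum_Polygamma z assms)
  also have "(-1) ^ Suc k * ((-1) ^ Suc k * Polygamma k (1 - z) / fact k) = ?T"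
    by (simp flip: power_add mult_2 add: mult.assoc[symmetric])
  also have "((\<lambda>n. (-1) ^ Suc k * inverse ((1 - z + of_nat n) ^ Suc k)) has_sum ?T) UNIV \<longleftrightarrow>
      (?f has_sum ?T) {..<0}"
  proof (rule has_sum_reindex_bij_witness[of _ "\<lambda>l. nat (-l - 1)" "\<lambda>n. - int n - 1"], goal_cases)
    \<comment> \<open>The negative indices are l = -n - 1, for which z + l = -(1 - z + n).\<close>
    case (5 n)
    have "z + of_int (- int n - 1) = (-1) * (1 - z + of_nat n)" by simp
    hence "inverse ((z + of_int (- int n - 1)) ^ Suc k) = inverse ((-1) ^ Suc k * (1 - z + of_nat n) ^ Suc k)"
      by (metis power_mult_distrib)
    also have "\<dots> = (-1) ^ Suc k * inverse ((1 - z + of_nat n) ^ Suc k)"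
      by (simp only: inverse_mult_distrib power_inverse[symmetric]) simp
    finally show ?case .
  qed auto
  finally have neg: "(?f has_sum ?T) {..<0}" .
  have "(?f has_sum (?S + ?T)) ({0..} \<union> {..<0})"
    by (intro has_sum_Un_disjoint pos neg) auto
  also have "{0..} \<union> {..<0::int} = UNIV" by auto
  also have "?S + ?T = (- 2 * of_real pi * \<i>) ^ Suc k / fact k * power_moment k (exp (2 * of_real pi * \<i> * z))"
  proof -
    obtain j where k: "k = Suc j" using assms(2) gr0_implies_Suc by blast
    have "?S + ?T = (-1) ^ k * ((-1) ^ k * Polygamma k (1 - z) - Polygamma k z) / fact k"
      by (simp add: algebra_simps add_divide_distrib diff_divide_distrib flip: power_add mult_2)
    also have "(-1) ^ k * Polygamma k (1 - z) - Polygamma k z =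
        - ((2 * of_real pi * \<i>) ^ Suc k * power_moment k (exp (2 * of_real pi * \<i> * z)))"
      using Polygamma_reflection_upper_half_plane[OF assms(1), of j] unfolding k by simp
    also have "(- 2 * of_real pi * \<i>) ^ Suc k = (-1) ^ Suc k * (2 * of_real pi * \<i>) ^ Suc k"
      by (simp flip: power_mult_distrib del: power_Suc)
    ultimately show ?thesis by simp
  qed
  finally show ?thesis .
qed

subsection \<open>Lambert series\<close>

lemma has_sum_sum:
  fixes f :: "'i \<Rightarrow> 'a \<Rightarrow> 'b :: topological_comm_monoid_add"
  assumes "\<And>i. i \<in> I \<Longrightarrow> (f i has_sum s i) A"
  shows "((\<lambda>x. \<Sum>i\<in>I. f i x) has_sum (\<Sum>i\<in>I. s i)) A"
  using assms by (induction I rule: infinite_finite_induct) (auto intro!: has_sum_add)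

lemma summable_on_product_nonneg:
  fixes f :: "'a \<Rightarrow> real" and g :: "'b \<Rightarrow> real"
  assumes "f summable_on A" "g summable_on B"
    and "\<And>x. x \<in> A \<Longrightarrow> f x \<ge> 0" "\<And>y. y \<in> B \<Longrightarrow> g y \<ge> 0"
  shows "(\<lambda>(x, y). f x * g y) summable_on A \<times> B"
proof (rule summable_on_SigmaI)
  fix x assume "x \<in> A"
  show "((\<lambda>y. case (x, y) of (x, y) \<Rightarrow> f x * g y) has_sum (f x * infsum g B)) B"
    using assms(2) by (simp add: has_sum_cmult_right)
qed (use assms in \<open>auto intro: summable_on_cmult_left\<close>)

lemma summable_on_inverse_square: "(\<lambda>n. inverse (real n ^ 2)) summable_on A"
proof -
  have "summable (\<lambda>n. inverse (real n ^ 2))"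
    by (intro inverse_power_summable) auto
  hence "(\<lambda>n. inverse (real n ^ 2)) summable_on UNIV"
    by (simp add: summable_on_UNIV_nonneg_real_iff)
  thus ?thesis by (rule summable_on_subset) auto
qed

lemma summable_on_inverse_sqrt_cube: "(\<lambda>n. inverse (sqrt (real n) ^ 3)) summable_on A"
proof -
  have "summable (\<lambda>n. real n powr (-3/2))"
    by (subst summable_real_powr_iff) auto
  also have "(\<lambda>n. real n powr (-3/2)) = (\<lambda>n. inverse (sqrt (real n) ^ 3))"
    by (auto simp: powr_half_sqrt[symmetric] powr_powr powr_minus simp flip: powr_realpow')
  finally have "(\<lambda>n. inverse (sqrt (real n) ^ 3)) summable_on UNIV"
    by (simp add: summable_on_UNIV_nonneg_real_iff)
  thus ?thesis by (rule summable_on_subset) auto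
qed

lemma summable_on_int_nonzero:
  fixes f :: "nat \<Rightarrow> real"
  assumes "f summable_on {1..}"
  shows "(\<lambda>l. f (nat \<bar>l\<bar>)) summable_on (- {0} :: int set)"
proof -
  have "f summable_on {1..} \<longleftrightarrow> (\<lambda>l. f (nat \<bar>l\<bar>)) summable_on {1::int..}"
    by (rule summable_on_reindex_bij_witness[of _ nat int]) auto
  moreover have "f summable_on {1..} \<longleftrightarrow> (\<lambda>l. f (nat \<bar>l\<bar>)) summable_on {..-1::int}"
    by (rule summable_on_reindex_bij_witness[of _ "\<lambda>l. nat (-l)" "\<lambda>n. - int n"]) auto
  ultimately have "(\<lambda>l. f (nat \<bar>l\<bar>)) summable_on ({1::int..} \<union> {..-1})"
    using assms by (intro summable_on_Un_disjoint) auto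
  also have "{1::int..} \<union> {..-1} = - {0}" by auto
  finally show ?thesis .
qed

text \<open>The exponential is bounded by the power -(k + 2) of \<open>m * n * y\<close>, which
  absorbs \<open>n ^ k\<close> and leaves a product of inverse squares. The bounded weight
  \<open>c\<close> may depend on both indices, so the original series and its dual are both
  covered.\<close>

lemma summable_on_lambert:
  fixes c :: "nat \<times> nat \<Rightarrow> complex" and y :: real
  assumes "\<And>p. norm (c p) \<le> 1" and "y > 0"
  shows "(\<lambda>(m, n). c (m, n) * of_nat n ^ k * exp (- of_real (real m * real n * y))) summable_on {1..} \<times> {1..}"
proof (rule Infinite_Sum.abs_summable_summable, rule Infinite_Sum.abs_summable_on_comparison_test')
  show "(\<lambda>p. fact (k + 2) / y ^ (k + 2) * (case p of (m, n) \<Rightarrow> inverse (real m ^ 2) * inverse (real n ^ 2)))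
          summable_on {1..} \<times> {1..}"
    by (intro summable_on_cmult_right summable_on_product_nonneg summable_on_inverse_square) auto
next
  fix p :: "nat \<times> nat" assume "p \<in> {1..} \<times> {1..}"
  then obtain m n where p: "p = (m, n)" and mn: "m \<ge> 1" "n \<ge> 1" by auto
  have "norm (c p * of_nat n ^ k * exp (- of_real (real m * real n * y))) =
      norm (c p) * real n ^ k * exp (- (real m * real n * y))"
    by (simp add: norm_mult norm_power)
  also have "\<dots> \<le> 1 * real n ^ k * exp (- (real m * real n * y))"
    using assms(1)[of p] by (intro mult_right_mono) auto
  also have "\<dots> \<le> 1 * real n ^ k * (fact (k + 2) / (real m * real n * y) ^ (k + 2))"
    using mn assms(2) by (intro mult_left_mono exp_minus_le_fact_div_power) auto
  also have "\<dots> = fact (k + 2) / y ^ (k + 2) * (inverse (real m ^ (k + 2)) * inverse (real n ^ 2))"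
    using mn by (simp add: power_mult_distrib power_add power2_eq_square divide_simps del: fact_Suc)
  also have "\<dots> \<le> fact (k + 2) / y ^ (k + 2) * (inverse (real m ^ 2) * inverse (real n ^ 2))"
    using mn assms(2) by (intro mult_left_mono mult_right_mono le_imp_inverse_le power_increasing) auto
  finally show "norm (case p of (m, n) \<Rightarrow> c (m, n) * of_nat n ^ k * exp (- of_real (real m * real n * y)))
      \<le> fact (k + 2) / y ^ (k + 2) * (case p of (m, n) \<Rightarrow> inverse (real m ^ 2) * inverse (real n ^ 2))"
    by (simp add: p)
qed

text \<open>By the inequality of arithmetic and geometric means, |my - 2 pi i l|^2 >= 4 pi y m|l|.
  With k + 1 >= 3 this bounds the terms by a constant times (m|l|)^(-3/2), a product of two summable
  functions of one variable.\<close>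

lemma summable_on_lattice:
  fixes c :: "nat \<times> int \<Rightarrow> complex" and y :: real
  assumes "\<And>p. norm (c p) \<le> 1" and "y > 0" and "k \<ge> 2"
  shows "(\<lambda>(m, l). c (m, l) * inverse ((of_real (real m * y) - 2 * of_real pi * \<i> * of_int l) ^ Suc k))
           summable_on {1..} \<times> - {0}"
proof (rule Infinite_Sum.abs_summable_summable, rule Infinite_Sum.abs_summable_on_comparison_test')
  define s where "s = sqrt (4 * pi * y)"
  have s: "s > 0" using assms(2) by (simp add: s_def)
  show "(\<lambda>p. inverse (s ^ Suc k) * (case p of (m, l) \<Rightarrow> inverse (sqrt (real m) ^ 3) * inverse (sqrt (real (nat \<bar>l\<bar>)) ^ 3)))
          summable_on {1..} \<times> - {0}"
    by (intro summable_on_cmult_right summable_on_product_nonneg summable_on_inverse_sqrt_cube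
          summable_on_int_nonzero[of "\<lambda>n. inverse (sqrt (real n) ^ 3)"]) auto
  fix p :: "nat \<times> int" assume "p \<in> {1..} \<times> - {0}"
  then obtain m l where p: "p = (m, l)" and ml: "m \<ge> 1" "l \<noteq> 0" by auto
  define n where "n = nat \<bar>l\<bar>"
  have n: "n \<ge> 1" "\<bar>real_of_int l\<bar> = real n" using ml by (auto simp: n_def)
  define R where "R = of_real (real m * y) - 2 * of_real pi * \<i> * of_int l"
  define u where "u = real m * real n"
  have "1 * 1 \<le> u" unfolding u_def using ml n by (intro mult_mono) auto
  hence u: "u \<ge> 1" by simp
  have "(norm R)\<^sup>2 = (m * y)\<^sup>2 + (2 * pi * l)\<^sup>2"
    unfolding cmod_power2 R_def by simp
  also have "\<dots> = (m * y)\<^sup>2 + (2 * pi * n)\<^sup>2"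
    by (metis n(2) power2_abs power_mult_distrib)
  also have "\<dots> \<ge> 2 * (m * y) * (2 * pi * n)"
    using sum_squares_bound[of "m * y" "2 * pi * n"] by simp
  also have "2 * (m * y) * (2 * pi * n) = (s * sqrt u)\<^sup>2"
    using u assms(2) by (simp add: s_def u_def power_mult_distrib)
  finally have R: "s * sqrt u \<le> norm R"
    by (rule power2_le_imp_le) auto
  \<comment> \<open>Because u >= 1, the exponent k + 1 may be lowered to 3, the smallest value
    allowed by k >= 2.\<close>
  have "s ^ Suc k * sqrt u ^ 3 \<le> s ^ Suc k * sqrt u ^ Suc k"
    using s u assms(3) by (intro mult_left_mono power_increasing) auto
  also have "\<dots> \<le> norm R ^ Suc k"
    unfolding power_mult_distrib[symmetric] using R s u by (intro power_mono) auto
  finally have le: "inverse (norm R ^ Suc k) \<le> inverse (s ^ Suc k * sqrt u ^ 3)"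
    using s u by (intro le_imp_inverse_le) auto
  have "norm (c p * inverse (R ^ Suc k)) \<le> 1 * inverse (norm R ^ Suc k)"
    unfolding norm_mult norm_inverse norm_power using assms(1)[of p] by (intro mult_right_mono) auto
  also have "\<dots> \<le> inverse (s ^ Suc k * sqrt u ^ 3)"
    using le by simp
  also have "\<dots> = inverse (s ^ Suc k) * (inverse (sqrt (real m) ^ 3) * inverse (sqrt (real n) ^ 3))"
    by (simp add: u_def real_sqrt_mult power_mult_distrib)
  finally show "norm (case p of (m, l) \<Rightarrow> c (m, l) * inverse ((of_real (real m * y) - 2 * of_real pi * \<i> * of_int l) ^ Suc k))
     \<le> inverse (s ^ Suc k) * (case p of (m, l) \<Rightarrow> inverse (sqrt (real m) ^ 3) * inverse (sqrt (real (nat \<bar>l\<bar>)) ^ 3))"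
    by (simp add: p R_def n_def)
qed

section \<open>Lipschitz sums on the imaginary axis and along residue classes\<close>

lemma exp_power_moment_has_sum:
  assumes "y > 0" "k > 0"
  shows "((\<lambda>n. of_nat n ^ k * exp (- of_real (real n * y))) has_sum power_moment k (exp (- of_real y))) {1..}"
proof -
  have "((\<lambda>n. of_nat n ^ k * exp (- of_real y) ^ n) has_sum power_moment k (exp (- of_real y))) {1..}"
    using assms by (intro has_sum_power_moment) auto
  thus ?thesis by (simp flip: exp_of_nat_mult)
qed

text \<open>The Lipschitz formula at z = iy/(2 pi), where exp(2 pi i z) = exp(-y). Scaling by -2 pi
  i turns z + l into y - 2 pi i l and cancels the constant of the formula.\<close>

lemma Lipschitz_exp_has_sum:
  assumes "y > 0" "k > 0"
  shows "((\<lambda>l::int. inverse ((of_real y - 2 * of_real pi * \<i> * of_int l) ^ Suc k)) has_sum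
          (power_moment k (exp (- of_real y)) / fact k)) UNIV"
proof -
  define z where "z = \<i> * of_real (y / (2 * pi))"
  define A where "A = - 2 * of_real pi * \<i>"
  have A: "A \<noteq> 0" by (simp add: A_def)
  have ez: "exp (2 * of_real pi * \<i> * z) = exp (- of_real y)"
    by (simp add: z_def)
  have "((\<lambda>l::int. inverse (A ^ Suc k) * inverse ((z + of_int l) ^ Suc k)) has_sum
      inverse (A ^ Suc k) * (A ^ Suc k / fact k * power_moment k (exp (2 * of_real pi * \<i> * z)))) UNIV"
    unfolding A_def by (intro has_sum_cmult_right Lipschitz_summation_formula) (use assms in \<open>auto simp: z_def\<close>)
  also have "(\<lambda>l::int. inverse (A ^ Suc k) * inverse ((z + of_int l) ^ Suc k)) =
      (\<lambda>l::int. inverse ((of_real y - 2 * of_real pi * \<i> * of_int l) ^ Suc k))"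
  proof
    fix l :: int
    have "A * (z + of_int l) = of_real y - 2 * of_real pi * \<i> * of_int l"
      by (simp add: A_def z_def algebra_simps)
    thus "inverse (A ^ Suc k) * inverse ((z + of_int l) ^ Suc k) =
        inverse ((of_real y - 2 * of_real pi * \<i> * of_int l) ^ Suc k)"
      by (metis inverse_mult_distrib power_mult_distrib)
  qed
  also have "inverse (A ^ Suc k) * (A ^ Suc k / fact k * power_moment k (exp (2 * of_real pi * \<i> * z))) =
      power_moment k (exp (- of_real y)) / fact k"
    using A unfolding ez by (simp add: field_simps)
  finally show ?thesis .
qed

lemma dirichlet_L_has_sum:
  assumes "dirichlet_character q \<psi>" "k > 0"
  shows "((\<lambda>m. \<psi> (int m) * inverse (of_nat m ^ Suc k)) has_sum dirichlet_L \<psi> (1 + of_nat k)) {1..}"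
proof -
  define f where "f n = \<psi> (int (Suc n)) / of_nat (Suc n) powr (1 + of_nat k)" for n
  have f: "f n = \<psi> (int (Suc n)) * inverse (of_nat (Suc n) ^ Suc k)" for n
  proof -
    have "(of_nat (Suc n) :: complex) powr (1 + of_nat k) = of_nat (Suc n) powr of_nat (Suc k)" by simp
    also have "\<dots> = of_nat (Suc n) ^ Suc k" by (subst powr_nat) (simp del: of_nat_Suc)
    finally show ?thesis by (simp add: f_def divide_inverse)
  qed
  have "summable (\<lambda>n. norm (f n))"
  proof (rule summable_comparison_test')
    have "summable (\<lambda>n. inverse (real n ^ Suc k))"
      using assms by (intro inverse_power_summable) auto
    thus "summable (\<lambda>n. inverse (real (Suc n) ^ Suc k))" by (subst summable_Suc_iff)
    fix n
    have "norm (f n) = norm (\<psi> (int (Suc n))) * inverse (real (Suc n) ^ Suc k)"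
      unfolding f norm_mult norm_inverse norm_power norm_of_nat ..
    also have "\<dots> \<le> 1 * inverse (real (Suc n) ^ Suc k)"
      using dirichlet_character_norm_le_1[OF assms(1)] by (intro mult_right_mono) auto
    finally show "norm (norm (f n)) \<le> inverse (real (Suc n) ^ Suc k)" by simp
  qed
  hence "(f has_sum dirichlet_L \<psi> (1 + of_nat k)) UNIV"
    unfolding dirichlet_L_def f_def[symmetric]
    by (intro norm_summable_imp_has_sum summable_sums) (auto intro: summable_norm_cancel)
  also have "?this \<longleftrightarrow> ?thesis"
    by (rule has_sum_reindex_bij_witness[of _ "\<lambda>n. n - 1" Suc]) (auto simp: f)
  finally show ?thesis .
qed

text \<open>On each residue class modulo \<open>q\<close> the character is constant and the
  Lipschitz formula applies. In the resulting power series the r-dependence of the n-th term is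
  \<open>\<psi> r\<close> times exp(2 pi i n r / q), so summing over r produces a twisted Gauss
  sum.\<close>

lemma Lipschitz_formula_twisted:
  assumes "primitive_character q \<psi>" and "y > 0" and "t > 0" and "k > 0"
  shows "((\<lambda>m::int. \<psi> m * inverse ((of_int m * of_real y + 2 * of_real pi * \<i> * of_real t) ^ Suc k)) has_sum
          ((- 2 * of_real pi * \<i> / of_real (real q * y)) ^ Suc k / fact k * gauss_sum q \<psi> *
           (\<Sum>\<^sub>\<infinity>n\<in>{1..}. cnj (\<psi> (int n)) * of_nat n ^ k * exp (- of_real (t * real n * (4 * pi\<^sup>2 / (real q * y))))))) UNIV"
proof -
  have dc: "dirichlet_character q \<psi>" using assms(1) unfolding primitive_character_def by blast
  have q: "q > 0" using dc unfolding dirichlet_character_def by blast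
  define Y where "Y = real q * y"
  have Y: "Y > 0" using q assms(2) by (simp add: Y_def)
  define A where "A = - 2 * of_real pi * \<i>"
  \<comment> \<open>Chosen so that \<open>Y * (z r + l)\<close> is the denominator at m = r + ql.
    The imaginary part is the same for all r and yields the common decay factor
    \<open>W\<close>.\<close>
  define z where "z r = of_int r / of_nat q + \<i> * of_real (2 * pi * t / Y)" for r :: int
  define e where "e r = exp (2 * of_real pi * \<i> * z r)" for r
  have Imz: "Im (z r) > 0" for r using Y assms(3) by (simp add: z_def)
  have ne: "norm (e r) < 1" for r unfolding e_def by (rule norm_exp_2pi_ii_less_1[OF Imz])
  define E where "E m = \<psi> m * inverse ((of_int m * of_real y + 2 * of_real pi * \<i> * of_real t) ^ Suc k)" for m :: int
  define B where "B r = {m. m mod int q = r}" for r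
  define s where "s r = \<psi> r * (inverse (of_real Y ^ Suc k) * (A ^ Suc k / fact k * power_moment k (e r)))" for r
  have Br: "(E has_sum s r) (B r)" if r: "r \<in> {0..<int q}" for r
  proof -
    have "((\<lambda>l::int. \<psi> r * (inverse (of_real Y ^ Suc k) * inverse ((z r + of_int l) ^ Suc k))) has_sum s r) UNIV"
      unfolding s_def A_def e_def
      by (intro has_sum_cmult_right Lipschitz_summation_formula Imz assms)
    also have "?this \<longleftrightarrow> (E has_sum s r) (B r)"
    proof (rule has_sum_reindex_bij_witness[of _ "\<lambda>m. m div int q" "\<lambda>l. r + int q * l"], goal_cases)
      case (5 l)
      have "of_real Y * (z r + of_int l) = of_int (r + int q * l) * of_real y + 2 * of_real pi * \<i> * of_real t"
        using q Y assms(2) by (simp add: z_def Y_def field_simps)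
      hence "inverse (of_real Y ^ Suc k) * inverse ((z r + of_int l) ^ Suc k) =
          inverse ((of_int (r + int q * l) * of_real y + 2 * of_real pi * \<i> * of_real t) ^ Suc k)"
        by (metis inverse_mult_distrib power_mult_distrib)
      thus ?case unfolding E_def dirichlet_character_add_mult[OF dc] by simp
    qed (use r q in \<open>auto simp: B_def\<close>)
    finally show ?thesis .
  qed
  have "(E has_sum (\<Sum>r\<in>{0..<int q}. s r)) (\<Union>r\<in>{0..<int q}. B r)"
    by (intro sum_has_sum Br) (auto simp: B_def)
  also have "(\<Union>r\<in>{0..<int q}. B r) = UNIV" using q by (auto simp: B_def)
  also have "(\<Sum>r\<in>{0..<int q}. s r) = inverse (of_real Y ^ Suc k) * (A ^ Suc k / fact k) *
      (\<Sum>r\<in>{0..<int q}. \<psi> r * power_moment k (e r))"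
    unfolding s_def sum_distrib_left by (intro sum.cong) auto
  also have "(\<Sum>r\<in>{0..<int q}. \<psi> r * power_moment k (e r)) =
      gauss_sum q \<psi> * (\<Sum>\<^sub>\<infinity>n\<in>{1..}. cnj (\<psi> (int n)) * of_nat n ^ k * exp (- of_real (t * real n * (4 * pi\<^sup>2 / Y))))"
  proof -
    define g where "g n = cnj (\<psi> (int n)) * of_nat n ^ k * exp (- of_real (t * real n * (4 * pi\<^sup>2 / Y)))" for n
    have "((\<lambda>n. \<Sum>r\<in>{0..<int q}. \<psi> r * (of_nat n ^ k * e r ^ n)) has_sum
            (\<Sum>r\<in>{0..<int q}. \<psi> r * power_moment k (e r))) {1..}"
      by (intro has_sum_sum has_sum_cmult_right has_sum_power_moment ne assms)
    also have "(\<lambda>n. \<Sum>r\<in>{0..<int q}. \<psi> r * (of_nat n ^ k * e r ^ n)) = (\<lambda>n. gauss_sum q \<psi> * g n)"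
    proof
      fix n :: nat
      define W where "W = exp (- of_real (t * real n * (4 * pi\<^sup>2 / Y)) :: complex)"
      have er: "e r ^ n = exp (2 * of_real pi * \<i> * of_int (int n * r) / of_nat q) * W" for r
      proof -
        have "e r ^ n = exp (of_nat n * (2 * of_real pi * \<i> * z r))"
          by (simp add: e_def exp_of_nat_mult)
        also have "of_nat n * (2 * of_real pi * \<i> * z r) =
            2 * of_real pi * \<i> * of_int (int n * r) / of_nat q - of_real (t * real n * (4 * pi\<^sup>2 / Y))"
          using q Y by (simp add: z_def field_simps power2_eq_square)
        finally show ?thesis by (simp add: W_def exp_diff exp_minus divide_inverse)
      qed
      have "(\<Sum>r\<in>{0..<int q}. \<psi> r * (of_nat n ^ k * e r ^ n)) =
          of_nat n ^ k * W * (\<Sum>r\<in>{0..<int q}. \<psi> r * exp (2 * of_real pi * \<i> * of_int (int n * r) / of_nat q))"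
        unfolding er sum_distrib_left by (intro sum.cong) auto
      also have "\<dots> = gauss_sum q \<psi> * g n"
        unfolding primitive_character_gauss_sum_twisted[OF assms(1)] g_def W_def by (simp add: mult_ac)
      finally show "(\<Sum>r\<in>{0..<int q}. \<psi> r * (of_nat n ^ k * e r ^ n)) = gauss_sum q \<psi> * g n" .
    qed
    finally have "((\<lambda>n. gauss_sum q \<psi> * g n) has_sum (\<Sum>r\<in>{0..<int q}. \<psi> r * power_moment k (e r))) {1..}" .
    from infsumI[OF this] show ?thesis
      unfolding g_def[symmetric] by (simp add: infsum_cmult_right')
  qed
  also have "inverse (of_real Y ^ Suc k) * (A ^ Suc k / fact k) = (A / of_real Y) ^ Suc k / fact k"
    unfolding power_divide by (simp add: divide_inverse mult_ac)
  finally show ?thesis unfolding E_def A_def Y_def by (simp only: mult.assoc)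
qed

text \<open>Two applications of the Lipschitz formula to one absolutely convergent lattice sum:
  summed over l first it gives the Lambert series without its l = 0 part, summed over m first it
  gives the dual series.\<close>

lemma lambert_modular_relation:
  assumes "primitive_character q \<psi>" and "odd_character \<psi>" and "even k" and "k \<ge> 2" and "y > 0"
  shows "(\<Sum>\<^sub>\<infinity>(m, n)\<in>{1..}\<times>{1..}. \<psi> (int m) * of_nat n ^ k * exp (- of_real (real m * real n * y))) =
     fact k * dirichlet_L \<psi> (1 + of_nat k) / of_real y ^ Suc k +
     (- 2 * of_real pi * \<i> / of_real (real q * y)) ^ Suc k * gauss_sum q \<psi> *
     (\<Sum>\<^sub>\<infinity>(m, n)\<in>{1..}\<times>{1..}. cnj (\<psi> (int n)) * of_nat n ^ k *
        exp (- of_real (real m * real n * (4 * pi\<^sup>2 / (real q * y)))))" (is "?T = ?main + ?C * gauss_sum q \<psi> * ?U")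
proof -
  have dc: "dirichlet_character q \<psi>" using assms(1) unfolding primitive_character_def by blast
  have q: "q > 0" and mult: "\<psi> (m * n) = \<psi> m * \<psi> n" for m n
    using dc unfolding dirichlet_character_def by auto
  have le1: "norm (\<psi> m) \<le> 1" for m by (rule dirichlet_character_norm_le_1[OF dc])
  have odd: "\<psi> (-m) = - \<psi> m" for m
    using mult[of "-1" m] assms(2) by (simp add: odd_character_def)
  have psi0: "\<psi> 0 = 0" using odd[of 0] by simp
  have k: "k > 0" using assms(4) by simp
  define L where "L = dirichlet_L \<psi> (1 + of_nat k)"
  define P where "P m = power_moment k (exp (- of_real (real m * y)))" for m
  define D where "D m l = \<psi> (int m) * inverse ((of_real (real m * y) - 2 * of_real pi * \<i> * of_int l) ^ Suc k)"
    for m :: nat and l :: int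
  \<comment> \<open>\<open>S\<close> is the value of the lattice sum over nonzero l; the subtracted
    term is the contribution of l = 0.\<close>
  define S where "S = ?T / fact k - L / of_real y ^ Suc k"

  have T: "((\<lambda>(m, n). \<psi> (int m) * of_nat n ^ k * exp (- of_real (real m * real n * y))) has_sum ?T) ({1..}\<times>{1..})"
    using summable_on_lambert[of "\<lambda>(m, n). \<psi> (int m)" y k] le1 assms(5) by (intro has_sum_infsum) auto
  have "((\<lambda>m. \<psi> (int m) * P m) has_sum ?T) {1..}"
  proof (rule has_sum_SigmaD[OF T])
    fix m :: nat assume m: "m \<in> {1..}"
    have "((\<lambda>n. \<psi> (int m) * (of_nat n ^ k * exp (- of_real (real n * (real m * y))))) has_sum \<psi> (int m) * P m) {1..}"
      unfolding P_def using m assms(5) k by (intro has_sum_cmult_right exp_power_moment_has_sum) auto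
    thus "((\<lambda>n. case (m, n) of (m, n) \<Rightarrow> \<psi> (int m) * of_nat n ^ k * exp (- of_real (real m * real n * y)))
        has_sum \<psi> (int m) * P m) {1..}"
      by (simp add: mult_ac)
  qed
  hence "((\<lambda>m. \<psi> (int m) * P m * inverse (fact k) + (- inverse (of_real y ^ Suc k)) * (\<psi> (int m) * inverse (of_nat m ^ Suc k)))
      has_sum ?T * inverse (fact k) + (- inverse (of_real y ^ Suc k)) * L) {1..}"
    unfolding L_def using dirichlet_L_has_sum[OF dc k]
    by (intro has_sum_add has_sum_cmult_left has_sum_cmult_right)
  hence S: "((\<lambda>m. \<psi> (int m) * P m / fact k - D m 0) has_sum S) {1..}"
    by (simp add: S_def D_def divide_inverse mult_ac power_mult_distrib)
  have Dm: "(D m has_sum (\<psi> (int m) * P m / fact k - D m 0)) (- {0})" if "m \<in> {1..}" for m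
  proof -
    have "(D m has_sum (\<psi> (int m) * (P m / fact k))) UNIV"
      unfolding D_def P_def using that assms(5) k
      by (intro has_sum_cmult_right Lipschitz_exp_has_sum) auto
    hence "(D m has_sum (\<psi> (int m) * (P m / fact k) - D m 0)) (UNIV - {0})"
      by (rule has_sum_Diff[OF _ has_sum_finiteI]) auto
    thus ?thesis by (simp add: Compl_eq_Diff_UNIV)
  qed
  \<comment> \<open>The iterated sum over rows determines the double sum only together with
    summability on the product set, which \<open>summable_on_lattice\<close> provides.\<close>
  have DS: "((\<lambda>(m, l). D m l) has_sum S) ({1..} \<times> - {0})"
  proof (rule has_sum_SigmaI[OF _ S])
    show "(\<lambda>(m, l). D m l) summable_on {1..} \<times> - {0}"
      using summable_on_lattice[of "\<lambda>(m, l). \<psi> (int m)" y k] le1 assms by (auto simp: D_def)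
  qed (use Dm in auto)

  \<comment> \<open>Since \<open>k + 1\<close> and \<open>\<psi>\<close> are odd, the terms with \<open>l > 0\<close> become those with negative \<open>m\<close>.\<close>
  define E where "E j m = \<psi> m * inverse ((of_int m * of_real y + 2 * of_real pi * \<i> * of_real (real j)) ^ Suc k)"
    for j :: nat and m :: int
  have "((\<lambda>(m, l). D m l) has_sum S) ({1..} \<times> - {0}) \<longleftrightarrow>
        ((\<lambda>(j, m). E j m) has_sum S) ({1..} \<times> - {0})"
  proof (rule has_sum_reindex_bij_witness[of _
        "\<lambda>(j, m). (nat \<bar>m\<bar>, - sgn m * int j)" "\<lambda>(m, l). (nat \<bar>l\<bar>, - sgn l * int m)"], goal_cases)
    case (5 p)
    then obtain m l where p: "p = (m, l)" "m \<ge> 1" "l \<noteq> 0" by auto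
    show ?case
    proof (cases "l < 0")
      case True
      thus ?thesis by (simp add: p D_def E_def)
    next
      case False
      hence l: "l > 0" using p by simp
      define X where "X = of_real (real m * y) - 2 * of_real pi * \<i> * of_int l"
      have X: "of_int (- int m) * of_real y + 2 * of_real pi * \<i> * of_real (real (nat l)) = - X"
        using l by (simp add: X_def)
      have "(- X) ^ Suc k = - (X ^ Suc k)" using assms(3) by simp
      hence "E (nat l) (- int m) = D m l"
        unfolding E_def D_def odd X X_def[symmetric] by (simp del: power_Suc)
      thus ?thesis using l by (simp add: p)
    qed
  qed (auto simp: abs_mult sgn_mult mult_sgn_abs sgn_0_0 split: prod.splits)
  \<comment> \<open>An odd character vanishes at 0, so m = 0 may be added. This completes m to all
    integers, as the twisted Lipschitz formula requires.\<close>
  also have "\<dots> \<longleftrightarrow> ((\<lambda>(j, m). E j m) has_sum S) ({1..} \<times> UNIV)"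
    by (rule has_sum_cong_neutral) (auto simp: E_def psi0)
  finally have ES: "((\<lambda>(j, m). E j m) has_sum S) ({1..} \<times> UNIV)" using DS by simp

  define G where "G j = (\<Sum>\<^sub>\<infinity>n\<in>{1..}. cnj (\<psi> (int n)) * of_nat n ^ k *
        exp (- of_real (real j * real n * (4 * pi\<^sup>2 / (real q * y)))))" for j :: nat
  have lhs: "((\<lambda>j. ?C / fact k * gauss_sum q \<psi> * G j) has_sum S) {1..}"
  proof (rule has_sum_SigmaD[OF ES])
    fix j :: nat assume "j \<in> {1..}"
    hence "real j > 0" by simp
    from Lipschitz_formula_twisted[OF assms(1,5) this k]
    show "((\<lambda>m. case (j, m) of (j, m) \<Rightarrow> E j m) has_sum ?C / fact k * gauss_sum q \<psi> * G j) UNIV"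
      unfolding E_def G_def by simp
  qed
  have summU: "(\<lambda>(m, n). cnj (\<psi> (int n)) * of_nat n ^ k *
        exp (- of_real (real m * real n * (4 * pi\<^sup>2 / (real q * y))))) summable_on ({1..}\<times>{1..})"
    using summable_on_lambert[of "\<lambda>(m, n). cnj (\<psi> (int n))" "4 * pi\<^sup>2 / (real q * y)" k] le1 assms(5) q by auto
  have "(G has_sum ?U) {1..}"
  proof (rule has_sum_SigmaD[OF has_sum_infsum[OF summU]])
    fix m :: nat assume "m \<in> {1..}"
    from summable_on_SigmaD1[OF summU this]
    show "((\<lambda>n. case (m, n) of (m, n) \<Rightarrow> cnj (\<psi> (int n)) * of_nat n ^ k *
        exp (- of_real (real m * real n * (4 * pi\<^sup>2 / (real q * y))))) has_sum G m) {1..}"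
      unfolding G_def by simp
  qed
  hence "((\<lambda>j. ?C / fact k * gauss_sum q \<psi> * G j) has_sum (?C / fact k * gauss_sum q \<psi> * ?U)) {1..}"
    by (rule has_sum_cmult_right)
  hence "S = ?C / fact k * gauss_sum q \<psi> * ?U"
    using lhs has_sum_unique by blast
  hence "fact k * S = ?C * gauss_sum q \<psi> * ?U" by (simp add: field_simps)
  moreover have "fact k * S = ?T - ?main" by (simp add: S_def L_def right_diff_distrib)
  ultimately show ?thesis by (simp add: algebra_simps)
qed

subsection \<open>Integrals\<close>

text \<open>Since b/t >= 0, the Gamma integrand dominates.\<close>

lemma bessel_integrand_absolutely_integrable:
  fixes b :: real and \<nu> :: complex
  assumes "b \<ge> 0" "Re \<nu> > 0"
  shows "(\<lambda>t. of_real t powr (\<nu> - 1) * exp (- of_real (t + b / t))) absolutely_integrable_on {0<..}"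
proof (rule measurable_bounded_by_integrable_imp_absolutely_integrable)
  show "(\<lambda>t. of_real t powr (\<nu> - 1) * exp (- of_real (t + b / t))) \<in> borel_measurable (lebesgue_on {0<..})"
    by (rule continuous_imp_measurable_on_sets_lebesgue) (auto intro!: continuous_intros)
  have "(\<lambda>t. complex_of_real t powr (\<nu> - 1) / of_real (exp t)) absolutely_integrable_on {0<..}"
    using assms(2) by (rule absolutely_integrable_Gamma_integral')
  thus "(\<lambda>t. norm (complex_of_real t powr (\<nu> - 1) / of_real (exp t))) integrable_on {0<..}"
    unfolding absolutely_integrable_on_def by (rule conjunct2)
  fix t :: real assume t: "t \<in> {0<..}"
  have ne: "norm (exp (- complex_of_real r)) = exp (- r)" for r by simp
  have "exp (- (t + b / t)) \<le> exp (- t)" using t assms(1) by simp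
  thus "norm (complex_of_real t powr (\<nu> - 1) * exp (- of_real (t + b / t))) \<le>
      norm (complex_of_real t powr (\<nu> - 1) / of_real (exp t))"
    unfolding norm_mult norm_divide ne by (simp add: exp_minus divide_inverse mult_left_mono)
qed auto

text \<open>The substitution t = sqrt(b) exp(u) makes t + b/t equal to 2 sqrt(b) cosh u and maps the
  real line onto the positive half-line. Folding the line at u = 0 turns exp(nu u) into 2 cosh(nu
  u), the integrand of \<open>besselK\<close>.\<close>

lemma bessel_integral:
  fixes b :: real and \<nu> :: complex
  assumes "b > 0" "Re \<nu> > 0"
  shows "integral {0<..} (\<lambda>t. of_real t powr (\<nu> - 1) * exp (- of_real (t + b / t))) =
         2 * of_real b powr (\<nu> / 2) * besselK \<nu> (2 * sqrt b)"
proof -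
  define f where "f t = of_real t powr (\<nu> - 1) * exp (- complex_of_real (t + b / t))" for t :: real
  define F where "F u = exp (- complex_of_real (2 * sqrt b * cosh u)) * exp (\<nu> * of_real u)" for u :: real
  define B where "B = complex_of_real b powr (\<nu> / 2)"
  have B: "B \<noteq> 0" using assms by (simp add: B_def)
  \<comment> \<open>The absolute value is the Jacobian; it raises the exponent from
    \<open>\<nu> - 1\<close> to \<open>\<nu>\<close>.\<close>
  have eqF: "\<bar>sqrt b * exp u\<bar> *\<^sub>R f (sqrt b * exp u) = B * F u" for u :: real
  proof -
    define g where "g = sqrt b * exp u"
    have g: "g > 0" using assms by (simp add: g_def)
    have bg: "b / g = sqrt b * exp (- u)"
      using assms by (simp add: g_def exp_minus field_simps)
    have "g + b / g = 2 * sqrt b * cosh u"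
      unfolding bg by (simp add: g_def cosh_field_def field_simps)
    moreover have "of_real g * complex_of_real g powr (\<nu> - 1) = of_real g powr \<nu>"
      using g by (simp add: powr_diff)
    moreover have "complex_of_real g powr \<nu> = B * exp (\<nu> * of_real u)"
    proof -
      have "ln g = ln b / 2 + u" using assms by (simp add: g_def ln_mult ln_sqrt)
      hence "complex_of_real g powr \<nu> = exp (\<nu> / 2 * of_real (ln b) + \<nu> * of_real u)"
        using g by (simp add: powr_def Ln_of_real algebra_simps)
      thus ?thesis using assms by (simp add: B_def powr_def Ln_of_real exp_add)
    qed
    ultimately show ?thesis
      unfolding g_def[symmetric] f_def F_def using g by (simp add: scaleR_conv_of_real mult.assoc[symmetric])
  qed
  have im: "(\<lambda>u. sqrt b * exp u) ` UNIV = {0<..}"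
  proof (intro equalityI subsetI)
    fix t :: real assume "t \<in> {0<..}"
    hence "t = sqrt b * exp (ln (t / sqrt b))" using assms by simp
    thus "t \<in> range (\<lambda>u. sqrt b * exp u)" by blast
  qed (use assms in auto)
  have fint: "f absolutely_integrable_on {0<..}"
    unfolding f_def using assms by (intro bessel_integrand_absolutely_integrable) auto
  have "(\<lambda>u. \<bar>sqrt b * exp u\<bar> *\<^sub>R f (sqrt b * exp u)) absolutely_integrable_on UNIV \<and>
        integral UNIV (\<lambda>u. \<bar>sqrt b * exp u\<bar> *\<^sub>R f (sqrt b * exp u)) = integral {0<..} f"
    using fint im
    by (subst has_absolute_integral_change_of_variables_real)
       (use assms in \<open>auto intro!: derivative_eq_intros inj_onI\<close>)
  hence BF: "(\<lambda>u. B * F u) absolutely_integrable_on UNIV" "integral UNIV (\<lambda>u. B * F u) = integral {0<..} f"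
    unfolding eqF by auto
  have "(\<lambda>u. inverse B * (B * F u)) absolutely_integrable_on UNIV"
    using BF(1) by (rule set_integrable_mult_right)
  hence Fint: "F absolutely_integrable_on UNIV" using B by (simp add: mult.assoc[symmetric])
  have Fpos: "F absolutely_integrable_on {0..}" and Fneg: "F absolutely_integrable_on {..0}"
    by (rule set_integrable_subset[OF Fint]; simp)+
  \<comment> \<open>Reflection in 0, with Jacobian |-1|, moves the integral over the negative
    half-line to the positive one.\<close>
  have "(\<lambda>u. \<bar>-1\<bar> *\<^sub>R F (- u)) absolutely_integrable_on {0..} \<and>
        integral {0..} (\<lambda>u. \<bar>-1\<bar> *\<^sub>R F (- u)) = integral {..0} F"
    using Fneg by (subst has_absolute_integral_change_of_variables_real)
       (auto intro!: derivative_eq_intros)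
  hence refl: "(\<lambda>u. F (- u)) absolutely_integrable_on {0..}" "integral {0..} (\<lambda>u. F (- u)) = integral {..0} F"
    by auto
  have int: "F integrable_on {0..}" "F integrable_on {..0}" "(\<lambda>u. F (- u)) integrable_on {0..}"
    using Fpos Fneg refl(1) by (auto dest: set_lebesgue_integral_eq_integral(1))
  have "integral ({..0} \<union> {0..}) F = integral {..0} F + integral {0..} F"
  proof (rule integral_Un)
    have "{..0} \<inter> {0::real..} = {0}" by auto
    thus "negligible ({..0} \<inter> {0::real..})" by simp
  qed (fact int)+
  also have "{..0} \<union> {0::real..} = UNIV" by auto
  also have "integral {..0} F + integral {0..} F = integral {0..} (\<lambda>u. F (- u) + F u)"
    using int refl(2) by (simp add: Henstock_Kurzweil_Integration.integral_add)
  also have "(\<lambda>u. F (- u) + F u) = (\<lambda>u. 2 * (exp (- of_real (2 * sqrt b * cosh u)) * cosh (\<nu> * of_real u)))"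
    by (auto simp: F_def cosh_field_def field_simps fun_eq_iff)
  also have "integral {0..} \<dots> = 2 * besselK \<nu> (2 * sqrt b)"
    by (simp add: besselK_def integral_mult_right)
  finally have "B * integral UNIV F = 2 * B * besselK \<nu> (2 * sqrt b)" by simp
  moreover have "integral UNIV (\<lambda>u. B * F u) = B * integral UNIV F"
    by (rule integral_mult_right)
  ultimately show ?thesis using BF(2) unfolding f_def B_def by argo
qed

text \<open>Substituting \<open>a * t\<close> for t in the Gamma integral pulls out the factor
  \<open>a powr s\<close>.\<close>

lemma Gamma_integral_scaled:
  fixes s :: complex and a :: real
  assumes "Re s > 0" "a > 0"
  shows "(\<lambda>t. of_real t powr (s - 1) * exp (- of_real (a * t))) absolutely_integrable_on {0<..}"
    and "integral {0<..} (\<lambda>t. of_real t powr (s - 1) * exp (- of_real (a * t))) = Gamma s / of_real a powr s"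
proof -
  define f where "f t = complex_of_real t powr (s - 1) / of_real (exp t)" for t :: real
  have "(\<lambda>t. complex_of_real t powr (s - 1) / of_real (exp (a * t))) absolutely_integrable_on {0<..}"
    using assms by (rule absolutely_integrable_Gamma_integral)
  thus int: "(\<lambda>t. of_real t powr (s - 1) * exp (- of_real (a * t))) absolutely_integrable_on {0<..}"
    by (simp add: exp_minus divide_inverse exp_of_real flip: of_real_mult)
  have im: "(\<lambda>t. a * t) ` {0<..} = {0<..}"
  proof (intro equalityI subsetI)
    fix t :: real assume "t \<in> {0<..}"
    hence "t = a * (t / a)" "t / a \<in> {0<..}" using assms by auto
    thus "t \<in> (\<lambda>t. a * t) ` {0<..}" by blast
  qed (use assms in auto)
  have "(\<lambda>t. \<bar>a\<bar> *\<^sub>R f (a * t)) absolutely_integrable_on {0<..} \<and>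
        integral {0<..} (\<lambda>t. \<bar>a\<bar> *\<^sub>R f (a * t)) = Gamma s"
    using absolutely_integrable_Gamma_integral'[OF assms(1), folded f_def] im
          integral_unique[OF Gamma_integral_complex'[OF assms(1), folded f_def]]
    by (subst has_absolute_integral_change_of_variables_real)
       (use assms in \<open>auto intro!: derivative_eq_intros inj_onI\<close>)
  hence "Gamma s = integral {0<..} (\<lambda>t. \<bar>a\<bar> *\<^sub>R f (a * t))" by simp
  also have "\<dots> = integral {0<..} (\<lambda>t. of_real a powr s * (of_real t powr (s - 1) * exp (- of_real (a * t))))"
  proof (rule integral_cong)
    fix t :: real assume t: "t \<in> {0<..}"
    have "of_real a * complex_of_real (a * t) powr (s - 1) = of_real a powr s * of_real t powr (s - 1)"
      using assms t by (simp add: powr_diff powr_times_real)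
    thus "\<bar>a\<bar> *\<^sub>R f (a * t) = of_real a powr s * (of_real t powr (s - 1) * exp (- of_real (a * t)))"
      using assms by (simp add: f_def scaleR_conv_of_real exp_minus divide_inverse exp_of_real mult.assoc[symmetric] flip: of_real_mult)
  qed
  also have "\<dots> = of_real a powr s * integral {0<..} (\<lambda>t. of_real t powr (s - 1) * exp (- of_real (a * t)))"
    by (rule integral_mult_right)
  finally show "integral {0<..} (\<lambda>t. of_real t powr (s - 1) * exp (- of_real (a * t))) = Gamma s / of_real a powr s"
    using assms by (simp add: field_simps)
qed

text \<open>The interchange of sum and integral takes place for the Lebesgue integral on
  \<open>S\<close>, justified by summability of the integrals of the norms; the values are then
  transferred to the gauge integral used elsewhere.\<close>

lemma integral_sums_termwise:
  fixes f :: "nat \<Rightarrow> real \<Rightarrow> complex"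
  assumes "\<And>i. f i absolutely_integrable_on S" and "S \<in> sets lebesgue"
    and "\<And>t. t \<in> S \<Longrightarrow> summable (\<lambda>i. norm (f i t))"
    and "summable (\<lambda>i. integral S (\<lambda>t. norm (f i t)))"
  shows "(\<lambda>i. integral S (f i)) sums integral S (\<lambda>t. \<Sum>i. f i t)"
    and "(\<lambda>t. \<Sum>i. f i t) integrable_on S"
proof -
  have int: "integrable (lebesgue_on S) (f i)" for i
    using assms(1,2) by (rule absolutely_integrable_imp_integrable)
  have eq: "integral\<^sup>L (lebesgue_on S) (f i) = integral S (f i)"
    "integral\<^sup>L (lebesgue_on S) (\<lambda>t. norm (f i t)) = integral S (\<lambda>t. norm (f i t))" for i
    using int assms(2) by (auto intro!: lebesgue_integral_eq_integral)
  have AE: "AE t in lebesgue_on S. summable (\<lambda>i. norm (f i t))"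
    using assms(3) by (intro AE_I2) auto
  have sm: "summable (\<lambda>i. integral\<^sup>L (lebesgue_on S) (\<lambda>t. norm (f i t)))"
    using assms(4) by (simp add: eq)
  have int': "integrable (lebesgue_on S) (\<lambda>t. \<Sum>i. f i t)"
    by (rule integrable_suminf[OF int AE sm])
  thus "(\<lambda>t. \<Sum>i. f i t) integrable_on S" using assms(2) by (rule integrable_on_lebesgue_on)
  from sums_integral[OF int AE sm] show "(\<lambda>i. integral S (f i)) sums integral S (\<lambda>t. \<Sum>i. f i t)"
    using lebesgue_integral_eq_integral[OF int' assms(2)] by (simp add: eq)
qed

subsection \<open>Growth of the divisor sums\<close>

text \<open>Replacing d by n/d takes out \<open>n ^ k\<close> and leaves a sum of d^(-k), which is
  at most the full series of inverse squares because k >= 2.\<close>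

lemma sum_divisors_power_bound:
  assumes "k \<ge> 2"
  obtains C where "C \<ge> 0" "\<And>n. n > 0 \<Longrightarrow> (\<Sum>d | d dvd n. real d ^ k) \<le> C * real n ^ k"
proof
  \<comment> \<open>This constant is zeta(2): the term at n = 0 is the inverse of 0, hence
    0.\<close>
  let ?C = "\<Sum>n. inverse (real n ^ 2)"
  have sm: "summable (\<lambda>n. inverse (real n ^ 2))" by (intro inverse_power_summable) auto
  show "?C \<ge> 0" by (intro suminf_nonneg sm) auto
  fix n :: nat assume n: "n > 0"
  have fin: "finite {d. d dvd n}" using n by simp
  have "(\<Sum>d | d dvd n. real d ^ k) = (\<Sum>d | d dvd n. real (n div d) ^ k)"
    by (rule sum.reindex_bij_witness[of _ "\<lambda>d. n div d" "\<lambda>d. n div d"]) (use n in auto)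
  also have "\<dots> \<le> (\<Sum>d | d dvd n. real n ^ k * inverse (real d ^ 2))"
  proof (rule sum_mono)
    fix d assume "d \<in> {d. d dvd n}"
    hence d: "d dvd n" "d > 0" using n by (auto intro: dvd_pos_nat)
    have "real (n div d) ^ k = real n ^ k * inverse (real d ^ k)"
      using d by (simp add: real_of_nat_div power_divide) (simp add: divide_inverse)
    also have "\<dots> \<le> real n ^ k * inverse (real d ^ 2)"
      using d assms by (intro mult_left_mono le_imp_inverse_le power_increasing) auto
    finally show "real (n div d) ^ k \<le> real n ^ k * inverse (real d ^ 2)" .
  qed
  also have "\<dots> = (\<Sum>d | d dvd n. inverse (real d ^ 2)) * real n ^ k"
    by (simp add: sum_distrib_left mult.commute)
  also have "\<dots> \<le> ?C * real n ^ k"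
    by (intro mult_right_mono sum_le_suminf sm fin) auto
  finally show "(\<Sum>d | d dvd n. real d ^ k) \<le> ?C * real n ^ k" .
qed

lemma sigma_chi_of_nat:
  assumes "n > 0"
  shows "sigma_chi (of_nat k) \<psi> n = (\<Sum>d | d dvd n. \<psi> (int d) * of_nat d ^ k)"
  unfolding sigma_chi_def using assms by (intro sum.cong refl) (auto simp: powr_nat)

lemma sigma_bar_chi_of_nat:
  assumes "n > 0"
  shows "sigma_bar_chi (of_nat k) \<psi> n = (\<Sum>d | d dvd n. \<psi> (int (n div d)) * of_nat d ^ k)"
  unfolding sigma_bar_chi_def using assms by (intro sum.cong refl) (auto simp: powr_nat)

text \<open>Bounded character values reduce both divisor sums to the unweighted one, so one constant
  serves the majorants on both sides of the identity.\<close>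

lemma sigma_chi_bounds:
  assumes "\<And>m. norm (\<psi> m) \<le> 1" and "k \<ge> 2"
  obtains C where "C \<ge> 0"
    and "\<And>n. n > 0 \<Longrightarrow> norm (sigma_chi (of_nat k) (\<lambda>m. cnj (\<psi> m)) n) \<le> C * real n ^ k"
    and "\<And>n. n > 0 \<Longrightarrow> norm (sigma_bar_chi (of_nat k) \<psi> n) \<le> C * real n ^ k"
proof -
  obtain C where C: "C \<ge> 0" "\<And>n. n > 0 \<Longrightarrow> (\<Sum>d | d dvd n. real d ^ k) \<le> C * real n ^ k"
    using sum_divisors_power_bound[OF assms(2)] by blast
  have *: "norm (\<Sum>d | d dvd n. c d * of_nat d ^ k) \<le> C * real n ^ k"
    if "n > 0" "\<And>d. norm (c d) \<le> 1" for n and c :: "nat \<Rightarrow> complex"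
  proof -
    have "norm (\<Sum>d | d dvd n. c d * of_nat d ^ k) \<le> (\<Sum>d | d dvd n. real d ^ k)"
    proof (rule sum_norm_le)
      fix d
      have "norm (c d) * real d ^ k \<le> 1 * real d ^ k" by (intro mult_right_mono that) auto
      thus "norm (c d * of_nat d ^ k) \<le> real d ^ k" by (simp add: norm_mult norm_power)
    qed
    also have "\<dots> \<le> C * real n ^ k" by (rule C(2)[OF that(1)])
    finally show ?thesis .
  qed
  show thesis
    by (rule that[OF C(1)]) (use assms(1) in \<open>auto simp: sigma_chi_of_nat sigma_bar_chi_of_nat intro!: *\<close>)
qed

lemma has_sum_from_1_imp_sums:
  assumes "(f has_sum S) {1::nat..}"
  shows "(\<lambda>n. f (Suc n)) sums S"
proof -
  have "(f has_sum S) {1..} \<longleftrightarrow> ((\<lambda>n. f (Suc n)) has_sum S) UNIV"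
    by (rule has_sum_reindex_bij_witness[of _ Suc "\<lambda>n. n - 1"]) auto
  thus ?thesis using assms has_sum_imp_sums by blast
qed

text \<open>Grouping both Lambert series of \<open>lambert_modular_relation\<close> by the product N
  = mn turns their coefficients into divisor sums.\<close>

lemma sigma_exp_modular_relation:
  assumes "primitive_character q \<psi>" and "odd_character \<psi>" and "even k" and "k \<ge> 2" and "y > 0"
  shows "(\<Sum>n. sigma_bar_chi (of_nat k) \<psi> (Suc n) * exp (- of_real (real (Suc n) * y))) =
     fact k * dirichlet_L \<psi> (1 + of_nat k) / of_real y ^ Suc k +
     (- 2 * of_real pi * \<i> / of_real (real q * y)) ^ Suc k * gauss_sum q \<psi> *
     (\<Sum>n. sigma_chi (of_nat k) (\<lambda>m. cnj (\<psi> m)) (Suc n) *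
        exp (- of_real (real (Suc n) * (4 * pi\<^sup>2 / (real q * y)))))"
proof -
  have dc: "dirichlet_character q \<psi>" using assms(1) unfolding primitive_character_def by blast
  hence q: "q > 0" unfolding dirichlet_character_def by blast
  \<comment> \<open>A general weight \<open>c\<close> treats both sides at once: the character on
    the cofactor gives \<open>sigma_bar_chi\<close>, the conjugate character on the divisor gives
    \<open>sigma_chi\<close>.\<close>
  have sums: "(\<lambda>n. (\<Sum>d | d dvd Suc n. c (Suc n div d, d) * of_nat d ^ k) * exp (- of_real (real (Suc n) * u))) sums
      (\<Sum>\<^sub>\<infinity>(m, n)\<in>{1..}\<times>{1..}. c (m, n) * of_nat n ^ k * exp (- of_real (real m * real n * u)))"
    if "u > 0" "\<And>p. norm (c p) \<le> 1" for u and c :: "nat \<times> nat \<Rightarrow> complex"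
  proof -
    have "((\<lambda>N. \<Sum>d | d dvd N. c (N div d, d) * of_nat d ^ k * exp (- of_real (real (N div d) * real d * u))) has_sum
        (\<Sum>\<^sub>\<infinity>(m, n)\<in>{1..}\<times>{1..}. c (m, n) * of_nat n ^ k * exp (- of_real (real m * real n * u)))) {1..}"
      using has_sum_divisors[OF has_sum_infsum[OF summable_on_lambert[OF that(2,1), where k = k]]] by simp
    from has_sum_from_1_imp_sums[OF this]
    have "(\<lambda>n. \<Sum>d | d dvd Suc n. c (Suc n div d, d) * of_nat d ^ k * exp (- of_real (real (Suc n div d) * real d * u))) sums
        (\<Sum>\<^sub>\<infinity>(m, n)\<in>{1..}\<times>{1..}. c (m, n) * of_nat n ^ k * exp (- of_real (real m * real n * u)))" .
    also have "(\<lambda>n. \<Sum>d | d dvd Suc n. c (Suc n div d, d) * of_nat d ^ k * exp (- complex_of_real (real (Suc n div d) * real d * u))) =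
        (\<lambda>n. (\<Sum>d | d dvd Suc n. c (Suc n div d, d) * of_nat d ^ k) * exp (- of_real (real (Suc n) * u)))"
    proof
      fix n
      have "real (Suc n div d) * real d = real (Suc n)" if "d dvd Suc n" for d
        using that by (metis dvd_div_mult_self of_nat_mult)
      thus "(\<Sum>d | d dvd Suc n. c (Suc n div d, d) * of_nat d ^ k * exp (- complex_of_real (real (Suc n div d) * real d * u))) =
        (\<Sum>d | d dvd Suc n. c (Suc n div d, d) * of_nat d ^ k) * exp (- of_real (real (Suc n) * u))"
        unfolding sum_distrib_right by (intro sum.cong refl) (simp only: mem_Collect_eq)
    qed
    finally show ?thesis .
  qed
  have le1: "norm (\<psi> m) \<le> 1" for m by (rule dirichlet_character_norm_le_1[OF dc])
  have y': "4 * pi\<^sup>2 / (real q * y) > 0" using q assms(5) by simp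
  have "(\<Sum>n. sigma_bar_chi (of_nat k) \<psi> (Suc n) * exp (- of_real (real (Suc n) * y))) =
     (\<Sum>\<^sub>\<infinity>(m, n)\<in>{1..}\<times>{1..}. \<psi> (int m) * of_nat n ^ k * exp (- of_real (real m * real n * y)))"
    using sums_unique[OF sums[of y "\<lambda>(m, n). \<psi> (int m)"]] le1 assms(5)
    by (simp add: sigma_bar_chi_of_nat case_prod_unfold)
  moreover have "(\<Sum>n. sigma_chi (of_nat k) (\<lambda>m. cnj (\<psi> m)) (Suc n) *
        exp (- of_real (real (Suc n) * (4 * pi\<^sup>2 / (real q * y))))) =
     (\<Sum>\<^sub>\<infinity>(m, n)\<in>{1..}\<times>{1..}. cnj (\<psi> (int n)) * of_nat n ^ k * exp (- of_real (real m * real n * (4 * pi\<^sup>2 / (real q * y)))))"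
    using sums_unique[OF sums[OF y', of "\<lambda>(m, n). cnj (\<psi> (int n))"]] le1
    by (simp add: sigma_chi_of_nat case_prod_unfold)
  ultimately show ?thesis
    using lambert_modular_relation[OF assms] by simp
qed

subsection \<open>Termwise integration\<close>

lemma summable_polynomial_growth_exp:
  fixes D :: "nat \<Rightarrow> complex" and y :: real
  assumes "C \<ge> 0" and "\<And>n. norm (D n) \<le> C * real (Suc n) ^ k" and "y > 0"
  shows "summable (\<lambda>n. norm (D n * exp (- of_real (real (Suc n) * y))))"
proof (rule summable_comparison_test')
  have "summable (\<lambda>n. inverse (real n ^ 2))" by (intro inverse_power_summable) auto
  hence "summable (\<lambda>n. inverse (real (Suc n) ^ 2))" by (subst summable_Suc_iff)
  thus "summable (\<lambda>n. C * fact (k + 2) / y ^ (k + 2) * inverse (real (Suc n) ^ 2))"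
    by (rule summable_mult)
  fix n :: nat
  define N where "N = real (Suc n)"
  have N: "N > 0" by (simp add: N_def)
  have "norm (D n * exp (- of_real (N * y))) = norm (D n) * exp (- (N * y))"
    by (simp add: norm_mult)
  also have "\<dots> \<le> (C * N ^ k) * (fact (k + 2) / (N * y) ^ (k + 2))"
    using assms N unfolding N_def by (intro mult_mono exp_minus_le_fact_div_power) auto
  also have "\<dots> = C * fact (k + 2) / y ^ (k + 2) * inverse (N ^ 2)"
    using N assms by (simp add: power_mult_distrib power_add power2_eq_square divide_simps del: fact_Suc)
  finally show "norm (norm (D n * exp (- of_real (real (Suc n) * y)))) \<le>
      C * fact (k + 2) / y ^ (k + 2) * inverse (real (Suc n) ^ 2)"
    unfolding N_def by simp
qed

text \<open>For t > 0 the norm of the integrand is the same integrand with the real exponent Re s,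
  so the integral is a real Gamma value.\<close>

lemma integral_norm_Gamma_scaled:
  fixes s :: complex and a :: real
  assumes "Re s > 0" "a > 0"
  shows "integral {0<..} (\<lambda>t. norm (of_real t powr (s - 1) * exp (- of_real (a * t)))) = Gamma (Re s) / a powr Re s"
proof -
  define r where "r = complex_of_real (Re s)"
  have r: "Re r > 0" using assms by (simp add: r_def)
  have "((\<lambda>t. of_real t powr (r - 1) * exp (- of_real (a * t))) has_integral (Gamma r / of_real a powr r)) {0<..}"
    using Gamma_integral_scaled[OF r assms(2)]
    by (metis integrable_integral set_lebesgue_integral_eq_integral(1))
  from has_integral_linear[OF this bounded_linear_Re]
  have "((\<lambda>t. Re (of_real t powr (r - 1) * exp (- of_real (a * t)))) has_integral Re (Gamma r / of_real a powr r)) {0<..}"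
    by (simp add: o_def)
  also have "Gamma r / of_real a powr r = of_real (Gamma (Re s) / a powr Re s)"
    using assms unfolding r_def by (simp add: Gamma_complex_of_real powr_of_real)
  finally have I: "((\<lambda>t. Re (of_real t powr (r - 1) * exp (- of_real (a * t)))) has_integral Gamma (Re s) / a powr Re s) {0<..}"
    by simp
  have "Re (of_real t powr (r - 1) * exp (- of_real (a * t))) = norm (of_real t powr (s - 1) * exp (- complex_of_real (a * t)))"
    if "t \<in> {0<..}" for t
  proof -
    have "of_real t powr (r - 1) = complex_of_real (t powr (Re s - 1))"
      using that by (simp add: r_def flip: powr_of_real)
    moreover have "exp (- complex_of_real (a * t)) = of_real (exp (- (a * t)))"
      by (metis exp_of_real of_real_minus)
    ultimately have "Re (of_real t powr (r - 1) * exp (- complex_of_real (a * t))) = t powr (Re s - 1) * exp (- (a * t))"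
      by (metis Re_complex_of_real of_real_mult)
    also have "\<dots> = norm (of_real t powr (s - 1) * exp (- complex_of_real (a * t)))"
      using that by (simp add: norm_mult norm_powr_real_powr)
    finally show ?thesis .
  qed
  thus ?thesis using integral_unique[OF I] by (metis (no_types, lifting) integral_cong)
qed

section \<open>Constants of the two terms, with powers written as exponentials of logarithms\<close>

lemma powr_pos_real_eq_exp:
  "r > 0 \<Longrightarrow> complex_of_real r powr z = exp (z * of_real (ln r))"
  by (simp add: powr_def Ln_of_real)

text \<open>Written as exponentials, the two sides differ only in the shape of an exponent that is
  linear in ln a, ln x and ln 2. The divisor \<open>2 * of_real c powr (\<nu> / 2)\<close> is the
  factor in front of the Bessel function in \<open>bessel_integral\<close>, apart from its
  dependence on n.\<close>

lemma main_term_constant: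
  fixes a x c :: real and \<nu> :: complex
  assumes "a > 0" "x > 0"
  defines "c \<equiv> a\<^sup>2 * x / 4"
  shows "1 / of_real c ^ Suc k / (2 * of_real c powr (\<nu> / 2)) =
    2 powr (\<nu> + 2 * of_nat k + 1) / (of_real a) powr (\<nu> + 2 * of_nat k + 2) * (of_real x) powr (- \<nu> / 2 - of_nat k - 1)"
proof -
  have c: "c > 0" "ln c = 2 * ln a + ln x - 2 * ln 2"
    using assms(1,2) ln_realpow[of 2 2] by (auto simp: c_def ln_mult ln_div ln_realpow)
  have two: "2 powr z = exp (z * complex_of_real (ln 2))" for z
    using powr_pos_real_eq_exp[of 2] by simp
  have ck: "complex_of_real c ^ Suc k = exp ((of_nat k + 1) * of_real (ln c))"
  proof -
    have "complex_of_real c ^ Suc k = of_real c powr of_nat (Suc k)"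
      using c by (subst powr_nat) auto
    thus ?thesis using c(1) by (simp add: powr_pos_real_eq_exp add.commute)
  qed
  have "1 / of_real c ^ Suc k / (2 * of_real c powr (\<nu> / 2)) =
     exp (- ((of_nat k + 1) * of_real (ln c)) - of_real (ln 2) - \<nu> / 2 * of_real (ln c))"
  proof -
    have e2: "exp (of_real (ln 2)) = (2::complex)" by (simp add: exp_of_real)
    show ?thesis unfolding ck powr_pos_real_eq_exp[OF c(1)] exp_diff e2 exp_minus
      by (simp only: divide_inverse inverse_mult_distrib mult_1_left mult.assoc)
  qed
  also have "\<dots> = 2 powr (\<nu> + 2 * of_nat k + 1) / (of_real a) powr (\<nu> + 2 * of_nat k + 2) * (of_real x) powr (- \<nu> / 2 - of_nat k - 1)"
    unfolding two powr_pos_real_eq_exp[OF assms(1)] powr_pos_real_eq_exp[OF assms(2)] exp_diff[symmetric] exp_add[symmetric] c(2)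
    by (rule arg_cong[of _ _ exp]) (simp add: field_simps)
  finally show ?thesis .
qed

text \<open>The sign and the factor i come from (-i)^(k+1) with k even; the remaining positive
  factors are compared through their logarithms.\<close>

lemma dual_term_constant:
  fixes a x c c' :: real and \<nu> :: complex
  assumes "a > 0" "x > 0" "q > 0" "even k"
  defines "c \<equiv> a\<^sup>2 * x / 4"
  defines "c' \<equiv> 4 * pi\<^sup>2 / (real q * c)"
  shows "(- 2 * of_real pi * \<i> / of_real (real q * c)) ^ Suc k / of_real c' powr (\<nu> + of_nat k + 1) / (2 * of_real c powr (\<nu> / 2)) =
    - (((-1) ^ (k div 2) * \<i> * (of_real (a * q)) powr \<nu> * (of_real x) powr (\<nu> / 2))
         / (2 powr (3 * \<nu> + of_nat k + 2) * (of_real pi) powr (2 * \<nu> + of_nat k + 1)))"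
proof -
  \<comment> \<open>The modulus of the base of the power, which itself equals -i d.\<close>
  define d where "d = 2 * pi / (real q * c)"
  have ln4: "ln (4::real) = 2 * ln 2" using ln_realpow[of 2 2] by simp
  have c: "c > 0" "ln c = 2 * ln a + ln x - 2 * ln 2"
    using assms(1,2) by (auto simp: c_def ln_mult ln_div ln_realpow ln4)
  have c': "c' > 0" "ln c' = 2 * ln 2 + 2 * ln pi - ln q - ln c"
    using assms(3) c(1) by (auto simp: c'_def ln_mult ln_div ln_realpow ln4)
  have d: "d > 0" "ln d = ln 2 + ln pi - ln q - ln c"
    using assms(3) c(1) by (auto simp: d_def ln_mult ln_div)
  have aq: "a * q > 0" "ln (a * q) = ln a + ln q" using assms by (auto simp: ln_mult)
  have two: "2 powr z = exp (z * complex_of_real (ln 2))" for z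
    using powr_pos_real_eq_exp[of 2] by simp
  have dk: "complex_of_real d ^ Suc k = exp ((of_nat k + 1) * of_real (ln d))"
  proof -
    have "complex_of_real d ^ Suc k = of_real d powr of_nat (Suc k)"
      using d by (subst powr_nat) auto
    thus ?thesis using d(1) by (simp add: powr_pos_real_eq_exp add.commute)
  qed
  have sgn: "(- \<i>) ^ Suc k = - ((-1) ^ (k div 2) * \<i>)"
  proof -
    obtain j where j: "k = 2 * j" using assms(4) by blast
    show ?thesis by (simp add: j power_mult)
  qed
  have "- 2 * of_real pi * \<i> / of_real (real q * c) = (- \<i>) * of_real d"
    by (simp add: d_def)
  hence A: "(- 2 * of_real pi * \<i> / of_real (real q * c)) ^ Suc k = - ((-1) ^ (k div 2) * \<i>) * of_real d ^ Suc k"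
    by (simp only: power_mult_distrib sgn)
  have B: "of_real d ^ Suc k / of_real c' powr (\<nu> + of_nat k + 1) / (2 * of_real c powr (\<nu> / 2)) =
     exp ((of_nat k + 1) * of_real (ln d) - (\<nu> + of_nat k + 1) * of_real (ln c') - of_real (ln 2) - \<nu> / 2 * of_real (ln c))"
  proof -
    have e2: "exp (of_real (ln 2)) = (2::complex)" by (simp add: exp_of_real)
    show ?thesis unfolding dk powr_pos_real_eq_exp[OF c(1)] powr_pos_real_eq_exp[OF c'(1)] exp_diff e2
      by (simp only: divide_inverse inverse_mult_distrib mult.assoc)
  qed
  also have "\<dots> = (of_real (a * q)) powr \<nu> * (of_real x) powr (\<nu> / 2) /
      (2 powr (3 * \<nu> + of_nat k + 2) * (of_real pi) powr (2 * \<nu> + of_nat k + 1))"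
    unfolding two powr_pos_real_eq_exp[OF aq(1)] powr_pos_real_eq_exp[OF assms(2)] powr_pos_real_eq_exp[OF pi_gt_zero]
      exp_add[symmetric] exp_diff[symmetric] aq(2) c'(2) d(2) c(2)
    by (rule arg_cong[of _ _ exp]) (simp add: field_simps)
  finally show ?thesis unfolding A
    by (metis (no_types, opaque_lifting) minus_mult_left mult.assoc times_divide_eq_right)
qed

text \<open>As X >= 0, the terms are at most of order n^(k - Re s), with exponent below -1.\<close>

lemma summable_shifted_powr:
  fixes D :: "nat \<Rightarrow> complex" and s :: complex
  assumes "C \<ge> 0" and "\<And>n. norm (D n) \<le> C * real (Suc n) ^ k" and "X \<ge> 0" and "Re s > real k + 1"
  shows "summable (\<lambda>n. norm (D n / (of_nat (Suc n) + of_real X) powr s))"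
proof (rule summable_comparison_test')
  have "summable (\<lambda>n. real n powr (real k - Re s))"
    using assms(4) by (subst summable_real_powr_iff) auto
  hence "summable (\<lambda>n. real (Suc n) powr (real k - Re s))" by (subst summable_Suc_iff)
  thus "summable (\<lambda>n. C * real (Suc n) powr (real k - Re s))" by (rule summable_mult)
  fix n :: nat
  define N where "N = real (Suc n)"
  have N: "N > 0" by (simp add: N_def)
  have "norm ((of_nat (Suc n) + of_real X) powr s) = (N + X) powr Re s"
  proof -
    have "(of_nat (Suc n) + of_real X :: complex) = of_real (N + X)" by (simp add: N_def)
    thus ?thesis using N assms(3) by (simp only:) (subst norm_powr_real_powr, auto)
  qed
  hence "norm (D n / (of_nat (Suc n) + of_real X) powr s) = norm (D n) / (N + X) powr Re s"
    by (simp add: norm_divide)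
  also have "\<dots> \<le> (C * N ^ k) / N powr Re s"
    using assms N unfolding N_def by (intro frac_le powr_mono2) auto
  also have "\<dots> = C * N powr (real k - Re s)"
    using N by (simp add: powr_diff powr_realpow)
  finally show "norm (norm (D n / (of_nat (Suc n) + of_real X) powr s)) \<le> C * real (Suc n) powr (real k - Re s)"
    unfolding N_def by simp
qed

text \<open>Integration of the modular relation at y = c/t against t^(nu-1) exp(-t). Both divisor
  series are integrated termwise: the left one yields Bessel functions, the dual one scaled Gamma
  integrals.\<close>

lemma bessel_series_sums:
  fixes \<nu> :: complex and c c' :: real and \<psi> :: "int \<Rightarrow> complex"
  assumes "primitive_character q \<psi>" and "odd_character \<psi>" and "even k" and "k \<ge> 2" and "c > 0" and "Re \<nu> > 0"
  defines "c' \<equiv> 4 * pi\<^sup>2 / (real q * c)" and "s \<equiv> \<nu> + of_nat k + 1"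
  shows "(\<lambda>n. sigma_bar_chi (of_nat k) \<psi> (Suc n) *
              (2 * of_real (real (Suc n) * c) powr (\<nu> / 2) * besselK \<nu> (2 * sqrt (real (Suc n) * c)))) sums
     (fact k * dirichlet_L \<psi> (1 + of_nat k) / of_real c ^ Suc k * Gamma s +
      (- 2 * of_real pi * \<i> / of_real (real q * c)) ^ Suc k * gauss_sum q \<psi> *
      (\<Sum>n. sigma_chi (of_nat k) (\<lambda>m. cnj (\<psi> m)) (Suc n) * (Gamma s / of_real (1 + real (Suc n) * c') powr s)))"
proof -
  have dc: "dirichlet_character q \<psi>" using assms(1) unfolding primitive_character_def by blast
  have q: "q > 0" using dc unfolding dirichlet_character_def by blast
  have c': "c' > 0" using q assms(5) by (simp add: c'_def)
  have s: "Re s > real k + 1" using assms(6) by (simp add: s_def)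
  define A where "A n = sigma_bar_chi (of_nat k) \<psi> (Suc n)" for n
  define B where "B n = sigma_chi (of_nat k) (\<lambda>m. cnj (\<psi> m)) (Suc n)" for n
  obtain C where C: "C \<ge> 0" and A: "\<And>n. norm (A n) \<le> C * real (Suc n) ^ k"
    and B: "\<And>n. norm (B n) \<le> C * real (Suc n) ^ k"
    using sigma_chi_bounds[of \<psi> k] dirichlet_character_norm_le_1[OF dc] assms(4)
    unfolding A_def B_def by (metis zero_less_Suc)
  define w where "w z t = complex_of_real t powr (z - 1) * exp (- of_real t)" for z t
  \<comment> \<open>\<open>f\<close> carries the exponentials in c/t, and \<open>h\<close> those of
    the dual series, whose decay c' t merges with exp(-t) into a single rate.\<close>
  define f where "f n t = A n * (of_real t powr (\<nu> - 1) * exp (- complex_of_real (t + real (Suc n) * c / t)))" for n and t :: real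
  define h where "h n t = B n * (of_real t powr (s - 1) * exp (- complex_of_real ((1 + real (Suc n) * c') * t)))" for n and t :: real
  have f_eq: "f n t = w \<nu> t * (A n * exp (- of_real (real (Suc n) * (c / t))))" for n t
  proof -
    have "exp (- complex_of_real (t + real (Suc n) * c / t)) = exp (- of_real t) * exp (- of_real (real (Suc n) * (c / t)))"
      by (subst exp_add[symmetric]) (rule arg_cong[of _ _ exp], simp)
    thus ?thesis unfolding f_def w_def by (simp only: mult_ac)
  qed
  have h_eq: "h n t = w s t * (B n * exp (- of_real (real (Suc n) * (c' * t))))" for n t
  proof -
    have "exp (- complex_of_real ((1 + real (Suc n) * c') * t)) = exp (- of_real t) * exp (- of_real (real (Suc n) * (c' * t)))"
      by (subst exp_add[symmetric]) (rule arg_cong[of _ _ exp], simp add: algebra_simps)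
    thus ?thesis unfolding h_def w_def by (simp only: mult_ac)
  qed
  have sumA: "summable (\<lambda>n. norm (A n * exp (- of_real (real (Suc n) * y))))" if "y > 0" for y
    using summable_polynomial_growth_exp[OF C A that] .
  have sumB: "summable (\<lambda>n. norm (B n * exp (- of_real (real (Suc n) * y))))" if "y > 0" for y
    using summable_polynomial_growth_exp[OF C B that] .

  have f_int: "f n absolutely_integrable_on {0<..}" for n
    unfolding f_def using assms(5,6)
    by (intro set_integrable_mult_right bessel_integrand_absolutely_integrable) auto
  have h_int: "h n absolutely_integrable_on {0<..}" for n
    unfolding h_def using s c'
    by (intro set_integrable_mult_right Gamma_integral_scaled) (auto intro: add_pos_pos)
  have f_pt: "summable (\<lambda>n. norm (f n t))" if "t \<in> {0<..}" for t
    unfolding f_eq norm_mult[of "w \<nu> t"] using that assms(5) by (intro summable_mult sumA) auto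
  have h_pt: "summable (\<lambda>n. norm (h n t))" if "t \<in> {0<..}" for t
    unfolding h_eq norm_mult[of "w s t"] using that c' by (intro summable_mult sumB) auto

  have f_norm: "summable (\<lambda>n. integral {0<..} (\<lambda>t. norm (f n t)))"
  proof (rule summable_comparison_test')
    \<comment> \<open>Bounding exp(-Nc/t) by its power of order k + 2 introduces t^(k+2). The
      majorant is therefore a Gamma integrand with this shifted argument, times an inverse square in
      N.\<close>
    define r where "r = \<nu> + of_nat (k + 2)"
    define I where "I = integral {0<..} (\<lambda>t. norm (of_real t powr (r - 1) * exp (- complex_of_real (1 * t))))"
    have r: "Re r > 0" using assms(6) by (simp add: r_def)
    define K where "K = C * fact (k + 2) / c ^ (k + 2)"
    have "summable (\<lambda>n. inverse (real n ^ 2))" by (intro inverse_power_summable) auto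
    hence "summable (\<lambda>n. inverse (real (Suc n) ^ 2))" by (subst summable_Suc_iff)
    thus "summable (\<lambda>n. K * I * inverse (real (Suc n) ^ 2))" by (rule summable_mult)
    fix n :: nat
    define N where "N = real (Suc n)"
    have N: "N > 0" by (simp add: N_def)
    have "integral {0<..} (\<lambda>t. norm (f n t)) \<le>
        integral {0<..} (\<lambda>t. K * inverse (N ^ 2) * norm (of_real t powr (r - 1) * exp (- complex_of_real (1 * t))))"
    proof (rule integral_le)
      show "(\<lambda>t. norm (f n t)) integrable_on {0<..}"
        using f_int[of n] unfolding absolutely_integrable_on_def by (rule conjunct2)
      have "(\<lambda>t. norm (of_real t powr (r - 1) * exp (- complex_of_real (1 * t)))) integrable_on {0<..}"
        using Gamma_integral_scaled(1)[OF r zero_less_one] unfolding absolutely_integrable_on_def by (rule conjunct2)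
      thus "(\<lambda>t. K * inverse (N ^ 2) * norm (of_real t powr (r - 1) * exp (- complex_of_real (1 * t)))) integrable_on {0<..}"
        by (rule integrable_on_mult_right)
      fix t :: real assume "t \<in> {0<..}"
      hence t: "t > 0" by simp
      have ne: "norm (exp (- complex_of_real u)) = exp (- u)" for u by simp
      have "norm (f n t) = norm (A n) * (t powr (Re \<nu> - 1) * exp (- t) * exp (- (N * (c / t))))"
        unfolding f_eq w_def norm_mult ne N_def using t by (simp add: norm_powr_real_powr)
      also have "\<dots> \<le> (C * N ^ k) * (t powr (Re \<nu> - 1) * exp (- t) * (fact (k + 2) / (N * (c / t)) ^ (k + 2)))"
        using C A[of n] N t assms(5) unfolding N_def
        by (intro mult_mono exp_minus_le_fact_div_power mult_nonneg_nonneg) auto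
      also have "\<dots> = K * inverse (N ^ 2) * (t powr (Re \<nu> - 1) * t ^ (k + 2) * exp (- t))"
        using N t assms(5)
        by (simp add: K_def power_mult_distrib power_divide power_add power2_eq_square divide_simps del: fact_Suc)
      also have "t powr (Re \<nu> - 1) * t ^ (k + 2) = t powr (Re r - 1)"
      proof -
        have "t ^ (k + 2) = t powr real (k + 2)" using t by (subst powr_realpow) auto
        thus ?thesis by (simp only: powr_add[symmetric]) (simp add: r_def algebra_simps)
      qed
      also have "t powr (Re r - 1) * exp (- t) = norm (of_real t powr (r - 1) * exp (- complex_of_real (1 * t)))"
        unfolding norm_mult ne using t by (simp add: norm_powr_real_powr)
      finally show "norm (f n t) \<le> K * inverse (N ^ 2) * norm (of_real t powr (r - 1) * exp (- complex_of_real (1 * t)))" .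
    qed
    also have "\<dots> = K * I * inverse (N ^ 2)"
      unfolding I_def integral_mult_right by simp
    finally have "integral {0<..} (\<lambda>t. norm (f n t)) \<le> K * I * inverse (N ^ 2)" .
    moreover have "integral {0<..} (\<lambda>t. norm (f n t)) \<ge> 0"
      using f_int[of n] unfolding absolutely_integrable_on_def
      by (intro Henstock_Kurzweil_Integration.integral_nonneg) auto
    ultimately show "norm (integral {0<..} (\<lambda>t. norm (f n t))) \<le> K * I * inverse (real (Suc n) ^ 2)"
      unfolding N_def by simp
  qed
  have h_norm: "summable (\<lambda>n. integral {0<..} (\<lambda>t. norm (h n t)))"
  proof -
    \<comment> \<open>Taking c' out of the rate 1 + Nc' leaves N + 1/c', the shifted form handled by
      \<open>summable_shifted_powr\<close>.\<close>
    have "integral {0<..} (\<lambda>t. norm (h n t)) =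
        Gamma (Re s) / c' powr Re s * norm (B n / (of_nat (Suc n) + of_real (1 / c')) powr s)" for n
    proof -
      define N where "N = real (Suc n)"
      have N: "N > 0" by (simp add: N_def)
      have "integral {0<..} (\<lambda>t. norm (h n t)) = norm (B n) * (Gamma (Re s) / (1 + N * c') powr Re s)"
        unfolding h_def norm_mult[of "B n"] integral_mult_right N_def
        using s c' by (subst integral_norm_Gamma_scaled) (auto intro: add_pos_pos)
      also have "1 + N * c' = c' * (N + 1 / c')" using c' by (simp add: field_simps)
      also have "(c' * (N + 1 / c')) powr Re s = c' powr Re s * (N + 1 / c') powr Re s"
        using c' N by (intro powr_mult)
      also have "(N + 1 / c') powr Re s = norm ((of_nat (Suc n) + of_real (1 / c')) powr s)"
      proof -
        have "(of_nat (Suc n) + of_real (1 / c') :: complex) = of_real (N + 1 / c')" by (simp add: N_def)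
        thus ?thesis using N c' by (simp only:) (subst norm_powr_real_powr, auto)
      qed
      finally show ?thesis by (simp add: norm_divide)
    qed
    thus ?thesis using summable_shifted_powr[OF C B _ s, of "1 / c'"] c' by (simp add: summable_mult)
  qed

  have f_val: "integral {0<..} (f n) = A n * (2 * of_real (real (Suc n) * c) powr (\<nu> / 2) * besselK \<nu> (2 * sqrt (real (Suc n) * c)))" for n
    unfolding f_def integral_mult_right using assms(5,6) by (subst bessel_integral) auto
  have h_val: "integral {0<..} (h n) = B n * (Gamma s / of_real (1 + real (Suc n) * c') powr s)" for n
    unfolding h_def integral_mult_right using s c' by (subst Gamma_integral_scaled) (auto intro: add_pos_pos)
  define M1 where "M1 = fact k * dirichlet_L \<psi> (1 + of_nat k) / of_real c ^ Suc k"
  define M2 where "M2 = (- 2 * of_real pi * \<i> / of_real (real q * c)) ^ Suc k * gauss_sum q \<psi>"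
  \<comment> \<open>The modular relation at y = c/t: both terms on its right carry y^(-k-1), hence a
    factor t^(k+1) that raises the exponent from \<open>\<nu>\<close> to \<open>s\<close>, and the
    dual argument becomes c' t, linear in t.\<close>
  have pt: "(\<Sum>n. f n t) = M1 * (of_real t powr (s - 1) * exp (- of_real (1 * t))) + M2 * (\<Sum>n. h n t)"
    if "t \<in> {0<..}" for t
  proof -
    from that have t: "t > 0" by simp
    have y: "c / t > 0" using t assms(5) by simp
    have y': "4 * pi\<^sup>2 / (real q * (c / t)) = c' * t" using t by (simp add: c'_def)
    have w: "w \<nu> t * of_real t ^ Suc k = w s t"
    proof -
      have "complex_of_real t powr (s - 1) = of_real t powr (\<nu> - 1) * of_real t powr of_nat (Suc k)"
        by (subst powr_add[symmetric]) (simp add: s_def algebra_simps)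
      also have "complex_of_real t powr of_nat (Suc k) = of_real t ^ Suc k"
        using t by (subst powr_nat) auto
      finally show ?thesis unfolding w_def by (simp only: mult_ac)
    qed
    have "(\<Sum>n. f n t) = w \<nu> t * (\<Sum>n. A n * exp (- of_real (real (Suc n) * (c / t))))"
      unfolding f_eq by (rule suminf_mult[OF summable_norm_cancel[OF sumA[OF y]]])
    also have "(\<Sum>n. A n * exp (- of_real (real (Suc n) * (c / t)))) =
        fact k * dirichlet_L \<psi> (1 + of_nat k) / of_real (c / t) ^ Suc k +
        (- 2 * of_real pi * \<i> / of_real (real q * (c / t))) ^ Suc k * gauss_sum q \<psi> *
        (\<Sum>n. B n * exp (- of_real (real (Suc n) * (c' * t))))"
      unfolding A_def B_def sigma_exp_modular_relation[OF assms(1-4) y] y' ..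
    also have "fact k * dirichlet_L \<psi> (1 + of_nat k) / of_real (c / t) ^ Suc k = M1 * of_real t ^ Suc k"
      unfolding M1_def of_real_divide power_divide by simp
    also have "(- 2 * of_real pi * \<i> / of_real (real q * (c / t))) ^ Suc k * gauss_sum q \<psi> = M2 * of_real t ^ Suc k"
    proof -
      have "- 2 * of_real pi * \<i> / of_real (real q * (c / t)) = - 2 * of_real pi * \<i> / of_real (real q * c) * of_real t"
        using t by simp
      thus ?thesis unfolding M2_def by (simp only: power_mult_distrib mult_ac)
    qed
    finally have "(\<Sum>n. f n t) = M1 * (w \<nu> t * of_real t ^ Suc k) +
        M2 * ((w \<nu> t * of_real t ^ Suc k) * (\<Sum>n. B n * exp (- of_real (real (Suc n) * (c' * t)))))"
      by (simp only: distrib_left mult_ac)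
    also have "\<dots> = M1 * w s t + M2 * (w s t * (\<Sum>n. B n * exp (- of_real (real (Suc n) * (c' * t)))))"
      unfolding w ..
    also have "w s t * (\<Sum>n. B n * exp (- of_real (real (Suc n) * (c' * t)))) = (\<Sum>n. h n t)"
      unfolding h_eq
      by (rule suminf_mult[OF summable_norm_cancel[OF sumB], symmetric]) (use t c' in simp)
    finally show ?thesis unfolding w_def by simp
  qed
  have S: "{0<..} \<in> sets (lebesgue :: real measure)" by simp
  note f_sums = integral_sums_termwise[OF f_int S f_pt f_norm]
  note h_sums = integral_sums_termwise[OF h_int S h_pt h_norm]
  \<comment> \<open>The l = 0 term contributes a plain Gamma integral; writing the rate as 1 matches
    \<open>Gamma_integral_scaled\<close>.\<close>
  have G: "((\<lambda>t. of_real t powr (s - 1) * exp (- complex_of_real (1 * t))) has_integral Gamma s) {0<..}"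
  proof -
    have "Re s > 0" using s by simp
    note * = Gamma_integral_scaled[OF this zero_less_one]
    show ?thesis
      using integrable_integral[OF set_lebesgue_integral_eq_integral(1)[OF *(1)]] unfolding *(2) by simp
  qed
  have "integral {0<..} (\<lambda>t. \<Sum>n. f n t) =
      integral {0<..} (\<lambda>t. M1 * (of_real t powr (s - 1) * exp (- of_real (1 * t))) + M2 * (\<Sum>n. h n t))"
    by (rule integral_cong) (rule pt)
  also have "\<dots> = M1 * Gamma s + M2 * integral {0<..} (\<lambda>t. \<Sum>n. h n t)"
    by (intro integral_unique has_integral_add has_integral_mult_right G integrable_integral h_sums(2))
  also have "integral {0<..} (\<lambda>t. \<Sum>n. h n t) = (\<Sum>n. B n * (Gamma s / of_real (1 + real (Suc n) * c') powr s))"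
    using sums_unique[OF h_sums(1)] unfolding h_val .
  finally have "(\<lambda>n. integral {0<..} (f n)) sums
      (M1 * Gamma s + M2 * (\<Sum>n. B n * (Gamma s / of_real (1 + real (Suc n) * c') powr s)))"
    using f_sums(1) by (simp only:)
  thus ?thesis unfolding f_val A_def B_def M1_def M2_def .
qed

theorem theorem2p3:
  fixes k q :: nat and \<psi> :: "int \<Rightarrow> complex" and a x :: real and \<nu> :: complex
  assumes "even k" and "k \<ge> 2"
    and "primitive_character q \<psi>" and "odd_character \<psi>"
    and "a > 0" and "x > 0"
    and "Re \<nu> > 0"
  shows "summable (\<lambda>n. sigma_chi (of_nat k) (\<lambda>m. cnj (\<psi> m)) (Suc n)
             / (of_nat (Suc n) + of_real (a^2 * q * x / (16 * pi^2))) powr (\<nu> + of_nat k + 1))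
    \<and> (\<lambda>n. sigma_bar_chi (of_nat k) \<psi> (Suc n) * (of_nat (Suc n)) powr (\<nu> / 2)
             * besselK \<nu> (a * sqrt (real (Suc n) * x)))
      sums
      (2 powr (\<nu> + 2 * of_nat k + 1) / (of_real a) powr (\<nu> + 2 * of_nat k + 2)
         * Gamma (of_nat k + 1) * Gamma (\<nu> + of_nat k + 1) * dirichlet_L \<psi> (1 + of_nat k)
         * (of_real x) powr (- \<nu> / 2 - of_nat k - 1)
       - ((-1) ^ (k div 2) * \<i> * (of_real (a * q)) powr \<nu> * (of_real x) powr (\<nu> / 2))
         / (2 powr (3 * \<nu> + of_nat k + 2) * (of_real pi) powr (2 * \<nu> + of_nat k + 1))
         * Gamma (\<nu> + of_nat k + 1) * gauss_sum q \<psi>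
         * (\<Sum>n. sigma_chi (of_nat k) (\<lambda>m. cnj (\<psi> m)) (Suc n)
             / (of_nat (Suc n) + of_real (a^2 * q * x / (16 * pi^2))) powr (\<nu> + of_nat k + 1)))"
proof -
  have dc: "dirichlet_character q \<psi>" using assms(3) unfolding primitive_character_def by blast
  have q: "q > 0" using dc unfolding dirichlet_character_def by blast
  define s where "s = \<nu> + of_nat k + 1"
  define c where "c = a\<^sup>2 * x / 4"
  define c' where "c' = 4 * pi\<^sup>2 / (real q * c)"
  \<comment> \<open>The shift in the dual series is 1/c': dividing 1 + Nc' by c' gives N +
    X.\<close>
  define X where "X = a^2 * q * x / (16 * pi^2)"
  have c: "c > 0" and c': "c' > 0" and X: "X > 0" "X = 1 / c'"
    using assms(5,6) q by (auto simp: c_def c'_def X_def)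
  define A where "A n = sigma_bar_chi (of_nat k) \<psi> (Suc n)" for n
  define B where "B n = sigma_chi (of_nat k) (\<lambda>m. cnj (\<psi> m)) (Suc n)" for n
  define L where "L = dirichlet_L \<psi> (1 + of_nat k)"
  define \<tau> where "\<tau> = gauss_sum q \<psi>"
  \<comment> \<open>The part of the Bessel prefactor that does not depend on n; dividing
    \<open>bessel_series_sums\<close> by it leaves the weight n^(nu/2) of the claim.\<close>
  define Q where "Q = 2 * complex_of_real c powr (\<nu> / 2)"
  have Q: "Q \<noteq> 0" using c by (simp add: Q_def)
  define U where "U = (\<Sum>n. B n / (of_nat (Suc n) + of_real X) powr s)"
  obtain C where "C \<ge> 0" "\<And>n. norm (B n) \<le> C * real (Suc n) ^ k"
    using sigma_chi_bounds[of \<psi> k] dirichlet_character_norm_le_1[OF dc] assms(2)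
    unfolding B_def by (metis zero_less_Suc)
  hence summ: "summable (\<lambda>n. B n / (of_nat (Suc n) + of_real X) powr s)"
    using X(1) assms(7)
    by (intro summable_norm_cancel[OF summable_shifted_powr[of C B k X s]]) (auto simp: s_def)
  have summand: "A n * (2 * of_real (real (Suc n) * c) powr (\<nu> / 2) * besselK \<nu> (2 * sqrt (real (Suc n) * c))) / Q =
      A n * of_nat (Suc n) powr (\<nu> / 2) * besselK \<nu> (a * sqrt (real (Suc n) * x))" for n
  proof -
    \<comment> \<open>This identity is the reason for choosing c = a^2 x / 4.\<close>
    have "2 * sqrt (real (Suc n) * c) = a * sqrt (real (Suc n) * x)"
      using assms(5) by (simp add: c_def real_sqrt_mult real_sqrt_divide)
    moreover have "complex_of_real (real (Suc n) * c) powr (\<nu> / 2) = of_nat (Suc n) powr (\<nu> / 2) * of_real c powr (\<nu> / 2)"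
      using c powr_times_real[of "of_nat (Suc n)" "of_real c" "\<nu> / 2"] by simp
    ultimately show ?thesis using Q unfolding Q_def by simp
  qed
  have "(\<Sum>n. B n * (Gamma s / of_real (1 + real (Suc n) * c') powr s)) =
      (\<Sum>n. Gamma s / of_real c' powr s * (B n / (of_nat (Suc n) + of_real X) powr s))"
  proof (rule suminf_cong)
    fix n
    have "complex_of_real (1 + real (Suc n) * c') = of_real c' * of_real (real (Suc n) + X)"
      unfolding of_real_mult[symmetric] X(2) using c' by (simp add: field_simps)
    also have "\<dots> powr s = of_real c' powr s * of_real (real (Suc n) + X) powr s"
      using c' X(1) by (intro powr_times_real) auto
    finally show "B n * (Gamma s / of_real (1 + real (Suc n) * c') powr s) =
        Gamma s / of_real c' powr s * (B n / (of_nat (Suc n) + of_real X) powr s)"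
      by simp
  qed
  also have "\<dots> = Gamma s / of_real c' powr s * U"
    unfolding U_def by (rule suminf_mult[OF summ])
  finally have dual: "(\<Sum>n. B n * (Gamma s / of_real (1 + real (Suc n) * c') powr s)) = Gamma s / of_real c' powr s * U" .
  have "(\<lambda>n. A n * of_nat (Suc n) powr (\<nu> / 2) * besselK \<nu> (a * sqrt (real (Suc n) * x))) sums
     ((fact k * L / of_real c ^ Suc k * Gamma s +
      (- 2 * of_real pi * \<i> / of_real (real q * c)) ^ Suc k * \<tau> * (Gamma s / of_real c' powr s * U)) / Q)"
    using sums_divide[OF bessel_series_sums[OF assms(3,4,1,2) c assms(7)], of Q]
    unfolding A_def[symmetric] B_def[symmetric] L_def[symmetric] \<tau>_def[symmetric] s_def[symmetric] c'_def[symmetric] summand dual .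
  also have "(fact k * L / of_real c ^ Suc k * Gamma s +
      (- 2 * of_real pi * \<i> / of_real (real q * c)) ^ Suc k * \<tau> * (Gamma s / of_real c' powr s * U)) / Q =
      (1 / of_real c ^ Suc k / Q) * (fact k * L * Gamma s) +
      ((- 2 * of_real pi * \<i> / of_real (real q * c)) ^ Suc k / of_real c' powr s / Q) * (Gamma s * \<tau> * U)"
    by (simp only: divide_inverse distrib_left distrib_right mult_1_left mult_ac)
  also have "1 / of_real c ^ Suc k / Q =
      2 powr (\<nu> + 2 * of_nat k + 1) / (of_real a) powr (\<nu> + 2 * of_nat k + 2) * (of_real x) powr (- \<nu> / 2 - of_nat k - 1)"
    unfolding Q_def c_def by (rule main_term_constant[OF assms(5,6)])
  also have "(- 2 * of_real pi * \<i> / of_real (real q * c)) ^ Suc k / of_real c' powr s / Q =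
    - (((-1) ^ (k div 2) * \<i> * (of_real (a * q)) powr \<nu> * (of_real x) powr (\<nu> / 2))
         / (2 powr (3 * \<nu> + of_nat k + 2) * (of_real pi) powr (2 * \<nu> + of_nat k + 1)))"
    unfolding Q_def c'_def c_def s_def by (rule dual_term_constant[OF assms(5,6) q assms(1)])
  also have "(fact k :: complex) = Gamma (of_nat k + 1)"
    by (metis Gamma_fact add.commute)
  finally show ?thesis
    using summ unfolding A_def B_def L_def \<tau>_def U_def s_def X_def
    by (simp only: mult_minus_left mult_minus_right add_uminus_conv_diff mult_ac simp_thms)
qed

end
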